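(* Let $\Omega\subset\mathbb{C}$ be a simply connected domain and let $X=(h,f):\Omega\to\mathbb{H}^2\times\mathbb{R}$ be a conformal minimal immersion. Let $K$ be the Gauss (intrinsic) curvature of $X$. If $w\in\Omega$ is such that $K(w)=0$, then the tangent plane of $X(\Omega)$ at $X(w)$ is vertical. Therefore, if $K\equiv0$, then $X(\Omega)$ is part of a vertical cylinder over a planar geodesic of $\mathbb{H}^2\times\mathbb{R}$; that is, there exists a geodesic $\Gamma$ of $\mathbb{H}^2\times\{t\}$ such that $X(\Omega)\subset\Gamma\times\mathbb{R}$.
   Context: $\mathbb{H}^2$ is the hyperbolic plane (curvature $-1$) and $\mathbb{H}^2\times\mathbb{R}$ carries the product metric. A tangent plane is vertical if it contains the direction $\partial_t$ of the $\mathbb{R}$ factor. For a geodesic $\Gamma$ of a slice $\mathbb{H}^2\times\{t\}$, identified with a geodesic of $\mathbb{H}^2$, the vertical cylinder over $\Gamma$ is $\Gamma\times\mathbb{R}\subset\mathbb{H}^2\times\mathbb{R}$. *)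

theory Defs
  imports "HOL-Analysis.Analysis"
begin

text \<open>The set \<open>S\<close> is meant to be open: the derivatives are taken in the whole space.\<close>

primrec Ck_on :: "nat \<Rightarrow> 'a::euclidean_space set \<Rightarrow> ('a \<Rightarrow> 'b::euclidean_space) \<Rightarrow> bool" where
  "Ck_on 0 S F \<longleftrightarrow> continuous_on S F"
| "Ck_on (Suc k) S F \<longleftrightarrow>
     (\<forall>p\<in>S. F differentiable (at p)) \<and> (\<forall>v. Ck_on k S (\<lambda>p. frechet_derivative F (at p) v))"

definition smooth_on :: "'a::euclidean_space set \<Rightarrow> ('a \<Rightarrow> 'b::euclidean_space) \<Rightarrow> bool" where
  "smooth_on S F \<longleftrightarrow> (\<forall>k. Ck_on k S F)"

text \<open>
  A Riemannian metric on an open subset of the vector space \<^typ>\<open>'a\<close> is a function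
  \<open>g\<close> such that \<open>g p u v\<close> is the inner product of the tangent vectors \<open>u\<close> and \<open>v\<close> at
  the point \<open>p\<close>.  A vector \<open>v\<close> also stands for the constant vector field with value \<open>v\<close>;
  constant fields commute, so the bracket terms in the formulas of Koszul and of the
  curvature tensor vanish.
\<close>

type_synonym 'a metric = "'a \<Rightarrow> 'a \<Rightarrow> 'a \<Rightarrow> real"

text \<open>
  \<open>christoffel g p u v\<close> is the Levi-Civita derivative at \<open>p\<close> of the constant field \<open>v\<close> in
  the direction \<open>u\<close>, characterised by the Koszul formula.
\<close>

definition christoffel :: "'a::euclidean_space metric \<Rightarrow> 'a \<Rightarrow> 'a \<Rightarrow> 'a \<Rightarrow> 'a" where
  "christoffel g p u v = (THE a. \<forall>w. g p a w =
     (frechet_derivative (\<lambda>q. g q v w) (at p) u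
      + frechet_derivative (\<lambda>q. g q u w) (at p) v
      - frechet_derivative (\<lambda>q. g q u v) (at p) w) / 2)"

text \<open>
  \<open>curvature_tensor g p u v w\<close> is \<open>R(u,v)w = \<nabla>\<^sub>u \<nabla>\<^sub>v w - \<nabla>\<^sub>v \<nabla>\<^sub>u w\<close>.
\<close>

definition curvature_tensor :: "'a::euclidean_space metric \<Rightarrow> 'a \<Rightarrow> 'a \<Rightarrow> 'a \<Rightarrow> 'a \<Rightarrow> 'a" where
  "curvature_tensor g p u v w =
     frechet_derivative (\<lambda>q. christoffel g q v w) (at p) u
     - frechet_derivative (\<lambda>q. christoffel g q u w) (at p) v
     + christoffel g p u (christoffel g p v w)
     - christoffel g p v (christoffel g p u w)"

definition sectional_curvature :: "'a::euclidean_space metric \<Rightarrow> 'a \<Rightarrow> 'a \<Rightarrow> 'a \<Rightarrow> real" where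
  "sectional_curvature g p u v =
     g p (curvature_tensor g p u v v) u / (g p u u * g p v v - (g p u v)\<^sup>2)"

definition gauss_curvature :: "complex metric \<Rightarrow> complex \<Rightarrow> real" where
  "gauss_curvature g p = sectional_curvature g p 1 \<i>"

definition geodesic :: "'a::euclidean_space metric \<Rightarrow> 'a set \<Rightarrow> (real \<Rightarrow> 'a) \<Rightarrow> bool" where
  "geodesic g M \<gamma> \<longleftrightarrow> (\<exists>\<gamma>'. \<forall>t. \<gamma> t \<in> M \<and> \<gamma>' t \<noteq> 0 \<and>
     (\<gamma> has_vector_derivative \<gamma>' t) (at t) \<and>
     (\<gamma>' has_vector_derivative - christoffel g (\<gamma> t) (\<gamma>' t) (\<gamma>' t)) (at t))"

text \<open>
  A surface is given by a parametrization \<open>X\<close> of an open subset of the complex plane,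
  with values in an open set carrying the metric \<open>g\<close>.
\<close>

definition tangent_plane :: "(complex \<Rightarrow> 'a::euclidean_space) \<Rightarrow> complex \<Rightarrow> 'a set" where
  "tangent_plane X w = range (frechet_derivative X (at w))"

definition induced_metric :: "'a::euclidean_space metric \<Rightarrow> (complex \<Rightarrow> 'a) \<Rightarrow> complex metric" where
  "induced_metric g X w u v =
     g (X w) (frechet_derivative X (at w) u) (frechet_derivative X (at w) v)"

definition conformal_immersion ::
    "'a::euclidean_space metric \<Rightarrow> complex set \<Rightarrow> (complex \<Rightarrow> 'a) \<Rightarrow> bool" where
  "conformal_immersion g \<Omega> X \<longleftrightarrow> smooth_on \<Omega> X \<and>
     (\<forall>w\<in>\<Omega>. inj (frechet_derivative X (at w)) \<and>
        (\<exists>c>0. \<forall>u v. induced_metric g X w u v = c * (u \<bullet> v)))"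

definition normal_part ::
    "'a::euclidean_space metric \<Rightarrow> (complex \<Rightarrow> 'a) \<Rightarrow> complex \<Rightarrow> 'a \<Rightarrow> 'a" where
  "normal_part g X w a =
     (THE n. a - n \<in> tangent_plane X w \<and> (\<forall>b\<in>tangent_plane X w. g (X w) n b = 0))"

text \<open>
  The argument of \<^const>\<open>normal_part\<close> is the ambient Levi-Civita derivative, in the direction
  \<open>u\<close> and along \<open>X\<close>, of the tangent field \<open>dX(v)\<close>.
\<close>

definition second_fundamental_form ::
    "'a::euclidean_space metric \<Rightarrow> (complex \<Rightarrow> 'a) \<Rightarrow> complex \<Rightarrow> complex \<Rightarrow> complex \<Rightarrow> 'a" where
  "second_fundamental_form g X w u v = normal_part g X w
     (frechet_derivative (\<lambda>q. frechet_derivative X (at q) v) (at w) u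
      + christoffel g (X w) (frechet_derivative X (at w) u) (frechet_derivative X (at w) v))"

text \<open>
  Half the trace of the second fundamental form with respect to the first one, whose
  coefficients in the basis \<open>1, \<i>\<close> are \<open>E, F, G\<close>.
\<close>

definition mean_curvature_vector ::
    "'a::euclidean_space metric \<Rightarrow> (complex \<Rightarrow> 'a) \<Rightarrow> complex \<Rightarrow> 'a" where
  "mean_curvature_vector g X w =
     (let E = induced_metric g X w 1 1;
          F = induced_metric g X w 1 \<i>;
          G = induced_metric g X w \<i> \<i>;
          A = second_fundamental_form g X w
      in (1 / (2 * (E * G - F\<^sup>2))) *\<^sub>R
           (G *\<^sub>R A 1 1 - (2 * F) *\<^sub>R A 1 \<i> + E *\<^sub>R A \<i> \<i>))"

definition minimal_surface ::
    "'a::euclidean_space metric \<Rightarrow> complex set \<Rightarrow> (complex \<Rightarrow> 'a) \<Rightarrow> bool" where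
  "minimal_surface g \<Omega> X \<longleftrightarrow> (\<forall>w\<in>\<Omega>. mean_curvature_vector g X w = 0)"

text \<open>The hyperbolic plane is the upper half-plane with the metric \<open>|dz|\<^sup>2 / (Im z)\<^sup>2\<close>.\<close>

definition H2 :: "complex set" where
  "H2 = {z. Im z > 0}"

definition H2_metric :: "complex metric" where
  "H2_metric p u v = (u \<bullet> v) / (Im p)\<^sup>2"

lemma christoffel_H2_metric: assumes "Im p > 0" shows "christoffel H2_metric p u v = \<i> * u * v / of_real (Im p)"
proof -
  have D: "frechet_derivative (\<lambda>q. H2_metric q a b) (at p) c = -2 * (a \<bullet> b) * Im c / (Im p)^3" for a b c
  proof -
    have "((\<lambda>q. H2_metric q a b) has_derivative (\<lambda>c. -2 * (a \<bullet> b) * Im c / (Im p)^3)) (at p)"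
      unfolding H2_metric_def using assms
      by (auto intro!: derivative_eq_intros simp: fun_eq_iff field_simps power2_eq_square power3_eq_cube)
    then show ?thesis by (simp add: frechet_derivative_at[symmetric])
  qed
  have eq: "H2_metric p (\<i> * u * v / of_real (Im p)) w = (-2 * (v \<bullet> w) * Im u / (Im p)^3 + -2 * (u \<bullet> w) * Im v / (Im p)^3 - -2 * (u \<bullet> v) * Im w / (Im p)^3) / 2" for w
    unfolding H2_metric_def using assms 
    by (simp add: inner_complex_def field_simps power2_eq_square power3_eq_cube Re_divide_of_real Im_divide_of_real)
  show ?thesis unfolding christoffel_def D
  proof (rule the_equality)
    fix a assume a: "\<forall>w. H2_metric p a w = (-2 * (v \<bullet> w) * Im u / (Im p)^3 + -2 * (u \<bullet> w) * Im v / (Im p)^3 - -2 * (u \<bullet> v) * Im w / (Im p)^3) / 2"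
    then have "H2_metric p a w = H2_metric p (\<i> * u * v / of_real (Im p)) w" for w using eq by metis
    then have "a \<bullet> w = (\<i> * u * v / of_real (Im p)) \<bullet> w" for w using assms by (simp add: H2_metric_def)
    then show "a = \<i> * u * v / of_real (Im p)" by (metis vector_eq_rdot)
  qed (use eq in simp)
qed

lemma gauss_curvature_H2_metric: "Im p > 0 \<Longrightarrow> gauss_curvature H2_metric p = -1"
proof -
  assume p: "Im p > 0"
  have D: "frechet_derivative (\<lambda>q. christoffel H2_metric q a b) (at p) c = - \<i> * a * b * Im c / (Im p)^2" for a b c
  proof -
    have 1: "((\<lambda>q. \<i> * a * b / complex_of_real (Im q)) has_derivative (\<lambda>c. - \<i> * a * b * Im c / (Im p)^2)) (at p)"
      using p by (auto intro!: derivative_eq_intros simp: fun_eq_iff field_simps power2_eq_square)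
    have "open {q. Im q > 0}" by (simp add: open_halfspace_Im_gt)
    then have "((\<lambda>q. christoffel H2_metric q a b) has_derivative (\<lambda>c. - \<i> * a * b * Im c / (Im p)^2)) (at p)"
      using has_derivative_transform_within_open[OF 1, of "{q. Im q > 0}" "\<lambda>q. christoffel H2_metric q a b"] p by (auto simp: christoffel_H2_metric)
    then show ?thesis by (simp add: frechet_derivative_at[symmetric])
  qed
  show ?thesis unfolding gauss_curvature_def sectional_curvature_def curvature_tensor_def D christoffel_H2_metric[OF p]
    using p by (simp add: H2_metric_def inner_complex_def field_simps power2_eq_square Re_divide_of_real Im_divide_of_real)
qed

definition H2R_metric :: "(complex \<times> real) metric" where
  "H2R_metric p u v = H2_metric (fst p) (fst u) (fst v) + snd u * snd v"

definition vertical_plane :: "(complex \<times> real) set \<Rightarrow> bool" where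
  "vertical_plane P \<longleftrightarrow> (0, 1) \<in> P"

definition H2_geodesic :: "complex set \<Rightarrow> bool" where
  "H2_geodesic \<Gamma> \<longleftrightarrow> (\<exists>\<gamma>. geodesic H2_metric H2 \<gamma> \<and> \<Gamma> = range \<gamma>)"

definition vertical_cylinder :: "complex set \<Rightarrow> (complex \<times> real) set" where
  "vertical_cylinder \<Gamma> = \<Gamma> \<times> UNIV"

end

theory Submission
  imports Defs
begin

text \<open>
  Write \<open>X = (h, f)\<close>, let \<open>l\<close> be the conformal factor of the induced metric, \<open>\<nabla>\<close> the Levi-Civita
  derivative of \<open>H\<^sup>2 \<times> \<real>\<close> along \<open>X\<close>, and \<open>J\<close> the Jacobian determinant of \<open>h\<close> measured in the
  hyperbolic metric.  A conformal immersion is minimal iff it is harmonic, so \<open>P = \<nabla>\<^sub>u X\<^sub>u\<close> satisfies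
  \<open>\<nabla>\<^sub>v X\<^sub>v = - P\<close>.  With \<open>Q = \<nabla>\<^sub>u X\<^sub>v\<close>, two differentiations of \<open>l = |X\<^sub>u|\<^sup>2\<close> give the Bochner formula
  \<open>\<Delta>l = 2|P|\<^sup>2 + 2|Q|\<^sup>2 + 2J\<^sup>2\<close>; the last term is what remains of commuting \<open>\<nabla>\<^sub>u\<close> and \<open>\<nabla>\<^sub>v\<close>, because the only
  curvature of the ambient space is the curvature \<open>-1\<close> of the hyperbolic factor.  The scalar
  products of \<open>P\<close> and \<open>Q\<close> with \<open>X\<^sub>u\<close> and \<open>X\<^sub>v\<close> are the first derivatives of \<open>l\<close> up to factors \<open>1/2\<close> and \<open>-1/2\<close>,
  so Bessel's inequality gives
  \<open>l \<Delta>l - |grad l|\<^sup>2 \<ge> 2 l J\<^sup>2\<close>, which is to say \<open>K \<le> - (J/l)\<^sup>2\<close> (\<open>gauss_curvature_le\<close>).  This is the Gauss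
  equation with the second fundamental form discarded; \<open>J/l\<close> is, up to sign, the angle function.
  Hence \<open>K = 0\<close> forces \<open>J = 0\<close>: some nonzero tangent vector of the surface has vanishing
  horizontal part, so it spans the vertical direction (\<open>flat_imp_vertical\<close>).

  If \<open>K\<close> vanishes identically, then \<open>h\<close> has rank at most one, and conformality forces
  \<open>h\<^sub>u = G f\<^sub>v\<close>, \<open>h\<^sub>v = - G f\<^sub>u\<close> for a nowhere vanishing complex function \<open>G\<close>
  (\<open>conformal_parallel_pair\<close>): \<open>h\<close> runs through a curve with velocity \<open>G\<close> and its parameter is, up to sign, a harmonic
  conjugate of \<open>f\<close>.  The harmonic map equation for \<open>h\<close> and the harmonicity of \<open>f\<close> turn into the geodesic
  equation for that curve.  The parameter enters through its differential \<open>\<omega> = f\<^sub>v du - f\<^sub>u dv\<close>: the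
  scalar products of the velocity of a geodesic with the Killing fields \<open>1\<close>, \<open>z\<close>, \<open>z\<^sup>2\<close> of the half-plane
  are first integrals, hence constant on the connected domain, and their values
  determine the line or half-circle that contains the image
  (\<open>image_subset_H2_geodesic\<close>).
\<close>

section \<open>Symmetry of second derivatives\<close>

abbreviation along :: "'a::real_normed_vector \<Rightarrow> ('a \<Rightarrow> 'b::real_normed_vector) \<Rightarrow> 'a \<Rightarrow> 'b" where
  "along v F \<equiv> (\<lambda>p. frechet_derivative F (at p) v)"

lemma mean_value_along:
  fixes F :: "'a::real_normed_vector \<Rightarrow> real"
  assumes s: "s > 0"
    and F: "\<And>x. 0 \<le> x \<Longrightarrow> x \<le> s \<Longrightarrow> (F has_derivative D (p + x *\<^sub>R a)) (at (p + x *\<^sub>R a))"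
  shows "\<exists>x. 0 < x \<and> x < s \<and> F (p + s *\<^sub>R a) - F p = s * D (p + x *\<^sub>R a) a"
proof -
  have lin: "D (p + x *\<^sub>R a) (h *\<^sub>R a) = h * D (p + x *\<^sub>R a) a" if "0 \<le> x" "x \<le> s" for x h
    using linear_cmul[OF has_derivative_linear[OF F[OF that]]] by simp
  have "((\<lambda>x. F (p + x *\<^sub>R a)) has_derivative (\<lambda>h. D (p + x *\<^sub>R a) (h *\<^sub>R a))) (at x within {0..s})"
    if "0 \<le> x" "x \<le> s" for x
    by (rule has_derivative_compose[of "\<lambda>x. p + x *\<^sub>R a", OF _ F[OF that]])
       (auto intro!: derivative_eq_intros)
  from mvt_simple[OF s, of "\<lambda>x. F (p + x *\<^sub>R a)", OF this]
  obtain x where "x \<in> {0<..<s}" "F (p + s *\<^sub>R a) - F (p + 0 *\<^sub>R a) = D (p + x *\<^sub>R a) ((s - 0) *\<^sub>R a)"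
    by auto
  then show ?thesis using lin[of x s] by (intro exI[of _ x]) auto
qed

text \<open>
  Applying the mean value theorem in the direction \<open>a\<close> and then in the direction \<open>b\<close> writes the second
  difference, which is symmetric in \<open>a\<close> and \<open>b\<close>, as a mixed second derivative at an intermediate point.
\<close>

lemma second_difference_mean_value:
  fixes F :: "'a::real_normed_vector \<Rightarrow> real"
  assumes s: "s > 0"
    and S: "\<And>x y. 0 \<le> x \<Longrightarrow> x \<le> s \<Longrightarrow> 0 \<le> y \<Longrightarrow> y \<le> s \<Longrightarrow> p + x *\<^sub>R a + y *\<^sub>R b \<in> S"
    and F: "\<And>q. q \<in> S \<Longrightarrow> (F has_derivative D q) (at q)"
    and Da: "\<And>q. q \<in> S \<Longrightarrow> ((\<lambda>q. D q a) has_derivative E q) (at q)"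
  shows "\<exists>x y. 0 < x \<and> x < s \<and> 0 < y \<and> y < s \<and>
    F (p + s *\<^sub>R a + s *\<^sub>R b) - F (p + s *\<^sub>R a) - F (p + s *\<^sub>R b) + F p
      = s * (s * E (p + x *\<^sub>R a + y *\<^sub>R b) b)"
proof -
  have "\<exists>x. 0 < x \<and> x < s \<and> (F (p + s *\<^sub>R a + s *\<^sub>R b) - F (p + s *\<^sub>R a)) - (F (p + s *\<^sub>R b) - F p)
      = s * (D (p + x *\<^sub>R a + s *\<^sub>R b) a - D (p + x *\<^sub>R a) a)"
  proof (rule mean_value_along[OF s, where F = "\<lambda>q. F (q + s *\<^sub>R b) - F q" 
      and D = "\<lambda>q c. D (q + s *\<^sub>R b) c - D q c"])
    fix x assume x: "0 \<le> x" "x \<le> s"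
    have 1: "(F has_derivative D (p + x *\<^sub>R a + s *\<^sub>R b)) (at (p + x *\<^sub>R a + s *\<^sub>R b))"
      by (rule F) (use S x s in auto)
    have 2: "(F has_derivative D (p + x *\<^sub>R a)) (at (p + x *\<^sub>R a))"
      by (rule F) (use S[of x 0] x s in auto)
    have 3: "((\<lambda>q. F (q + s *\<^sub>R b)) has_derivative D (p + x *\<^sub>R a + s *\<^sub>R b)) (at (p + x *\<^sub>R a))"
      by (rule has_derivative_compose[of "\<lambda>q. q + s *\<^sub>R b", OF _ 1])
         (auto intro!: derivative_eq_intros)
    show "((\<lambda>q. F (q + s *\<^sub>R b) - F q) has_derivative (\<lambda>c. D (p + x *\<^sub>R a + s *\<^sub>R b) c - D (p + x *\<^sub>R a) c))
       (at (p + x *\<^sub>R a))"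
      by (rule has_derivative_diff[OF 3 2])
  qed
  then obtain x where x: "0 < x" "x < s" and
    eq: "F (p + s *\<^sub>R a + s *\<^sub>R b) - F (p + s *\<^sub>R a) - F (p + s *\<^sub>R b) + F p
      = s * (D (p + x *\<^sub>R a + s *\<^sub>R b) a - D (p + x *\<^sub>R a) a)"
    by (auto simp: algebra_simps)
  have "\<exists>y. 0 < y \<and> y < s \<and> D (p + x *\<^sub>R a + s *\<^sub>R b) a - D (p + x *\<^sub>R a) a
      = s * E (p + x *\<^sub>R a + y *\<^sub>R b) b"
    by (rule mean_value_along[OF s, where F = "\<lambda>q. D q a"])
       (use S x s in \<open>auto intro!: Da\<close>)
  then show ?thesis using x eq by metis
qed

text \<open>
  Both mixed derivatives, each taken at some intermediate point of the same small parallelogram,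
  equal the second difference divided by \<open>s\<^sup>2\<close>; continuity moves both points to \<open>p\<close>.
\<close>

lemma second_derivative_symmetric_real:
  fixes F :: "'a::real_normed_vector \<Rightarrow> real"
  assumes S: "open S" "p \<in> S"
    and F: "\<And>q. q \<in> S \<Longrightarrow> (F has_derivative D q) (at q)"
    and Da: "\<And>q. q \<in> S \<Longrightarrow> ((\<lambda>q. D q a) has_derivative A q) (at q)"
    and Db: "\<And>q. q \<in> S \<Longrightarrow> ((\<lambda>q. D q b) has_derivative B q) (at q)"
    and A: "continuous_on S (\<lambda>q. A q b)" and B: "continuous_on S (\<lambda>q. B q a)"
  shows "A p b = B p a"
proof (rule ccontr)
  assume ne: "A p b \<noteq> B p a"
  \<comment> \<open>Half the gap, so that it stays open when both sides vary by less than \<open>e\<close>.\<close>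
  define e where "e = \<bar>A p b - B p a\<bar> / 2"
  have e: "e > 0" using ne by (simp add: e_def)
  have near: "\<exists>d>0. ball p d \<subseteq> S \<and> (\<forall>q\<in>ball p d. \<bar>G q - G p\<bar> < e)" if "continuous_on S G" for G :: "'a \<Rightarrow> real"
  proof -
    obtain d where d: "d > 0" "\<And>q. q \<in> S \<Longrightarrow> dist q p < d \<Longrightarrow> dist (G q) (G p) < e"
      using \<open>continuous_on S G\<close> S(2) e unfolding continuous_on_iff by metis
    obtain d' where d': "d' > 0" "ball p d' \<subseteq> S" using S open_contains_ball by metis
    show ?thesis
      by (rule exI[of _ "min d d'"]) (use d d' in \<open>auto simp: dist_real_def dist_commute subset_iff\<close>)
  qed
  obtain d1 where d1: "d1 > 0" "ball p d1 \<subseteq> S" "\<forall>q\<in>ball p d1. \<bar>A q b - A p b\<bar> < e"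
    using near[OF A] by auto
  obtain d2 where d2: "d2 > 0" "ball p d2 \<subseteq> S" "\<forall>q\<in>ball p d2. \<bar>B q a - B p a\<bar> < e"
    using near[OF B] by auto
  define d where "d = min d1 d2"
  have d: "d > 0" using d1 d2 by (simp add: d_def)
  define s where "s = d / (2 * (norm a + norm b + 1))"
  have s: "s > 0" using d by (simp add: s_def add_nonneg_pos)
  have sd: "s * norm a + s * norm b < d"
  proof -
    have "s * (norm a + norm b + 1) = d / 2"
      using add_nonneg_pos[of "norm a + norm b" 1] by (simp add: s_def field_simps)
    then show ?thesis using d s by (simp add: algebra_simps)
  qed
  have in_ball: "p + x *\<^sub>R a + y *\<^sub>R b \<in> ball p d" if "0 \<le> x" "x \<le> s" "0 \<le> y" "y \<le> s" for x y
  proof -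
    have "norm (x *\<^sub>R a + y *\<^sub>R b) \<le> x * norm a + y * norm b"
      using norm_triangle_ineq[of "x *\<^sub>R a" "y *\<^sub>R b"] that by simp
    also have "\<dots> \<le> s * norm a + s * norm b"
      using that by (intro add_mono mult_right_mono) auto
    finally show ?thesis using sd by (simp add: dist_norm norm_minus_commute add.commute)
  qed
  have bS: "ball p d \<subseteq> S" using d1 by (auto simp: d_def)
  have square_in_S: "p + x *\<^sub>R a + y *\<^sub>R b \<in> S" "p + y *\<^sub>R b + x *\<^sub>R a \<in> S"
    if "0 \<le> x" "x \<le> s" "0 \<le> y" "y \<le> s" for x y
    using in_ball[OF that] bS by (auto simp: add_ac)
  obtain x y where xy: "0 < x" "x < s" "0 < y" "y < s" and
    eq1: "F (p + s *\<^sub>R a + s *\<^sub>R b) - F (p + s *\<^sub>R a) - F (p + s *\<^sub>R b) + F p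
      = s * (s * A (p + x *\<^sub>R a + y *\<^sub>R b) b)"
    using second_difference_mean_value[OF s square_in_S(1) F Da] by blast
  obtain y' x' where xy': "0 < x'" "x' < s" "0 < y'" "y' < s" and
    eq2: "F (p + s *\<^sub>R b + s *\<^sub>R a) - F (p + s *\<^sub>R b) - F (p + s *\<^sub>R a) + F p
      = s * (s * B (p + y' *\<^sub>R b + x' *\<^sub>R a) a)"
    using second_difference_mean_value[OF s square_in_S(2) F Db] by blast
  have comm: "p + y' *\<^sub>R b + x' *\<^sub>R a = p + x' *\<^sub>R a + y' *\<^sub>R b"
    "p + s *\<^sub>R b + s *\<^sub>R a = p + s *\<^sub>R a + s *\<^sub>R b"
    by simp_all
  have "s * (s * A (p + x *\<^sub>R a + y *\<^sub>R b) b) = s * (s * B (p + x' *\<^sub>R a + y' *\<^sub>R b) a)"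
    using eq1 eq2 unfolding comm by linarith
  then have eq: "A (p + x *\<^sub>R a + y *\<^sub>R b) b = B (p + x' *\<^sub>R a + y' *\<^sub>R b) a"
    using s by simp
  have "\<bar>A (p + x *\<^sub>R a + y *\<^sub>R b) b - A p b\<bar> < e"
    using d1(3) in_ball[of x y] xy by (auto simp: d_def)
  moreover have "\<bar>B (p + x' *\<^sub>R a + y' *\<^sub>R b) a - B p a\<bar> < e"
    using d2(3) in_ball[of x' y'] xy' by (auto simp: d_def)
  ultimately show False unfolding eq e_def by argo
qed

lemma smooth_on_along: "smooth_on S F \<Longrightarrow> smooth_on S (along v F)"
  unfolding smooth_on_def by (metis Ck_on.simps(2))

lemma smooth_on_has_derivative:
  assumes "smooth_on S F" "p \<in> S"
  shows "(F has_derivative (\<lambda>v. along v F p)) (at p)"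
proof -
  have "Ck_on 1 S F" using assms(1) unfolding smooth_on_def by blast
  then have "F differentiable at p" using assms(2) by simp
  then show ?thesis by (simp add: frechet_derivative_works)
qed

lemma along_symmetric:
  fixes F :: "'a::euclidean_space \<Rightarrow> 'b::euclidean_space"
  assumes F: "smooth_on S F" and S: "open S" "p \<in> S"
  shows "along b (along a F) p = along a (along b F) p"
proof (rule euclidean_eqI)
  fix e :: 'b assume "e \<in> Basis"
  have C: "continuous_on S (along v (along w F))" for v w
    using smooth_on_along[OF smooth_on_along[OF F]] unfolding smooth_on_def
    by (metis Ck_on.simps(1))
  note D = smooth_on_has_derivative[OF F] smooth_on_has_derivative[OF smooth_on_along[OF F]]
  show "along b (along a F) p \<bullet> e = along a (along b F) p \<bullet> e"
    by (rule second_derivative_symmetric_real[OF S, where F = "\<lambda>q. F q \<bullet> e" and D = "\<lambda>q v. along v F q \<bullet> e"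
      and A = "\<lambda>q v. along v (along a F) q \<bullet> e" and B = "\<lambda>q v. along v (along b F) q \<bullet> e"])
     (auto intro!: continuous_intros C has_derivative_inner_left D)
qed

section \<open>The product metric\<close>

lemma H2R_metric_algebra:
  "H2R_metric p (a + b) c = H2R_metric p a c + H2R_metric p b c"
  "H2R_metric p (a - b) c = H2R_metric p a c - H2R_metric p b c"
  "H2R_metric p (- a) c = - H2R_metric p a c"
  "H2R_metric p (r *\<^sub>R a) c = r * H2R_metric p a c"
  "H2R_metric p c (a + b) = H2R_metric p c a + H2R_metric p c b"
  "H2R_metric p c (a - b) = H2R_metric p c a - H2R_metric p c b"
  "H2R_metric p c (- a) = - H2R_metric p c a"
  "H2R_metric p c (r *\<^sub>R a) = r * H2R_metric p c a"
  "H2R_metric p 0 c = 0" "H2R_metric p c 0 = 0"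
  by (simp_all add: H2R_metric_def H2_metric_def inner_simps algebra_simps add_divide_distrib diff_divide_distrib)

lemma H2R_metric_commute: "H2R_metric p a b = H2R_metric p b a"
  by (simp add: H2R_metric_def H2_metric_def inner_commute)

lemma H2R_metric_nonneg: "H2R_metric p a a \<ge> 0"
  by (simp add: H2R_metric_def H2_metric_def)

lemma H2R_metric_eq_0_iff: "Im (fst p) \<noteq> 0 \<Longrightarrow> H2R_metric p a a = 0 \<longleftrightarrow> a = 0"
  by (auto simp: H2R_metric_def H2_metric_def add_nonneg_eq_0_iff prod_eq_iff)

lemma christoffel_H2R_metric:
  assumes "Im (fst p) > 0"
  shows "christoffel H2R_metric p u v = (\<i> * fst u * fst v / of_real (Im (fst p)), 0)"
proof -
  define z where "z = fst p"
  have z: "Im z > 0" using assms by (simp add: z_def)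
  have D: "frechet_derivative (\<lambda>q. H2R_metric q a b) (at p) c
      = -2 * (fst a \<bullet> fst b) * Im (fst c) / (Im z)^3" for a b c
  proof -
    have "((\<lambda>q. H2R_metric q a b) has_derivative
        (\<lambda>c. -2 * (fst a \<bullet> fst b) * Im (fst c) / (Im z)^3)) (at p)"
      unfolding H2R_metric_def H2_metric_def z_def using assms
      by (auto intro!: derivative_eq_intros simp: fun_eq_iff field_simps power2_eq_square power3_eq_cube)
    then show ?thesis by (simp add: frechet_derivative_at[symmetric])
  qed
  define k where "k w = (-2 * (fst v \<bullet> fst w) * Im (fst u) / (Im z)^3
      + -2 * (fst u \<bullet> fst w) * Im (fst v) / (Im z)^3
      - -2 * (fst u \<bullet> fst v) * Im (fst w) / (Im z)^3) / 2" for w :: "complex \<times> real"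
  have eq: "H2R_metric p (\<i> * fst u * fst v / of_real (Im z), 0) w = k w" for w
    unfolding H2R_metric_def H2_metric_def z_def[symmetric] k_def using z
    by (simp add: inner_complex_def field_simps power2_eq_square power3_eq_cube
        Re_divide_of_real Im_divide_of_real)
  show ?thesis unfolding christoffel_def D z_def[symmetric] k_def[symmetric]
  proof (rule the_equality)
    fix a assume a: "\<forall>w. H2R_metric p a w = k w"
    have "H2R_metric p (a - (\<i> * fst u * fst v / of_real (Im z), 0)) w = 0" for w
      unfolding H2R_metric_algebra eq a[rule_format] by simp
    then show "a = (\<i> * fst u * fst v / of_real (Im z), 0)"
      using H2R_metric_eq_0_iff[of p] assms by (metis less_irrefl right_minus_eq)
  qed (use eq in simp)
qed

text \<open>
  The bound is the nonnegativity of the squared length of the component of \<open>x\<close> normal to \<open>a\<close> and \<open>b\<close>,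
  scaled by \<open>E\<close>.
\<close>

lemma bessel_H2R_metric:
  assumes E: "E > 0" "H2R_metric p a a = E" "H2R_metric p b b = E" "H2R_metric p a b = 0"
  shows "(H2R_metric p x a)\<^sup>2 + (H2R_metric p x b)\<^sup>2 \<le> E * H2R_metric p x x"
proof -
  define r where "r = E *\<^sub>R x - H2R_metric p x a *\<^sub>R a - H2R_metric p x b *\<^sub>R b"
  have "0 \<le> H2R_metric p r r" by (rule H2R_metric_nonneg)
  also have "H2R_metric p r r
      = E * (E * H2R_metric p x x - (H2R_metric p x a)\<^sup>2 - (H2R_metric p x b)\<^sup>2)"
    unfolding r_def H2R_metric_algebra E(2,3,4) H2R_metric_commute[of p b a]
      H2R_metric_commute[of p a x] H2R_metric_commute[of p b x]
    by (simp add: E(4) algebra_simps power2_eq_square)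
  finally show ?thesis using E(1) by (simp add: zero_le_mult_iff)
qed

section \<open>The curvature of a conformal metric\<close>

lemma has_derivative_Complex:
  assumes "(f has_derivative f') F" "(g has_derivative g') F"
  shows "((\<lambda>x. Complex (f x) (g x)) has_derivative (\<lambda>c. Complex (f' c) (g' c))) F"
  unfolding Complex_eq
  by (intro has_derivative_add has_derivative_mult_right has_derivative_of_real assms)

lemma christoffel_conformal:
  fixes g :: "complex metric"
  assumes S: "open S" "p \<in> S" and g: "\<And>q u v. q \<in> S \<Longrightarrow> g q u v = l q * (u \<bullet> v)"
    and l: "l p > 0" and dl: "(l has_derivative (\<lambda>c. l1 * Re c + l2 * Im c)) (at p)"
  shows "christoffel g p u v =
    ((l1 * Re u + l2 * Im u) *\<^sub>R v + (l1 * Re v + l2 * Im v) *\<^sub>R u - (u \<bullet> v) *\<^sub>R Complex l1 l2) /\<^sub>R (2 * l p)"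
    (is "_ = ?a")
proof -
  have D: "frechet_derivative (\<lambda>q. g q a b) (at p) c = (l1 * Re c + l2 * Im c) * (a \<bullet> b)" for a b c
  proof -
    have "((\<lambda>q. l q * (a \<bullet> b)) has_derivative (\<lambda>c. (l1 * Re c + l2 * Im c) * (a \<bullet> b))) (at p)"
      by (intro has_derivative_mult_left dl)
    then have "((\<lambda>q. g q a b) has_derivative (\<lambda>c. (l1 * Re c + l2 * Im c) * (a \<bullet> b))) (at p)"
      by (rule has_derivative_transform_within_open[OF _ S]) (simp add: g)
    then show ?thesis by (simp add: frechet_derivative_at[symmetric])
  qed
  have eq: "g p ?a w = ((l1 * Re u + l2 * Im u) * (v \<bullet> w) + (l1 * Re v + l2 * Im v) * (u \<bullet> w)
      - (l1 * Re w + l2 * Im w) * (u \<bullet> v)) / 2" for w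
    using l by (simp add: g[OF S(2)] inner_complex_def field_simps)
  show ?thesis unfolding christoffel_def D
  proof (rule the_equality)
    fix a assume "\<forall>w. g p a w = ((l1 * Re u + l2 * Im u) * (v \<bullet> w) + (l1 * Re v + l2 * Im v) * (u \<bullet> w)
      - (l1 * Re w + l2 * Im w) * (u \<bullet> v)) / 2"
    then have "g p a w = g p ?a w" for w using eq by metis
    then have "a \<bullet> w = ?a \<bullet> w" for w using l by (simp add: g[OF S(2)])
    then show "a = ?a" by (metis vector_eq_rdot)
  qed (use eq in simp)
qed

text \<open>
  This is Liouville's formula \<open>K = - \<Delta> log l / (2 l)\<close>, with the logarithm expanded so that only the
  first partial derivatives \<open>l1\<close>, \<open>l2\<close> of \<open>l\<close> and their derivatives \<open>d1\<close>, \<open>d2\<close> appear.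
\<close>

lemma gauss_curvature_conformal:
  fixes g :: "complex metric"
  assumes S: "open S" "p \<in> S" and g: "\<And>q u v. q \<in> S \<Longrightarrow> g q u v = l q * (u \<bullet> v)"
    and l: "\<And>q. q \<in> S \<Longrightarrow> l q > 0"
    and dl: "\<And>q. q \<in> S \<Longrightarrow> (l has_derivative (\<lambda>c. l1 q * Re c + l2 q * Im c)) (at q)"
    and dl1: "(l1 has_derivative d1) (at p)" and dl2: "(l2 has_derivative d2) (at p)"
  shows "gauss_curvature g p = - (l p * (d1 1 + d2 \<i>) - ((l1 p)\<^sup>2 + (l2 p)\<^sup>2)) / (2 * (l p)^3)"
proof -
  have C: "christoffel g q u v = ((l1 q * Re u + l2 q * Im u) *\<^sub>R v + (l1 q * Re v + l2 q * Im v) *\<^sub>R u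
      - (u \<bullet> v) *\<^sub>R Complex (l1 q) (l2 q)) /\<^sub>R (2 * l q)" if "q \<in> S" for q u v
    by (rule christoffel_conformal[OF S(1) that g l dl]) (use that in auto)
  have lp: "l p > 0" using l S by blast
  have "((\<lambda>q. Complex (- l1 q / (2 * l q)) (l2 q / (2 * l q))) has_derivative
     (\<lambda>c. Complex ((l1 p * (l1 p * Re c + l2 p * Im c) - l p * d1 c) / (2 * (l p)\<^sup>2))
       ((l p * d2 c - l2 p * (l1 p * Re c + l2 p * Im c)) / (2 * (l p)\<^sup>2)))) (at p)"
    using lp
    by (intro has_derivative_Complex; auto intro!: derivative_eq_intros dl dl1 dl2 S simp: fun_eq_iff field_simps power2_eq_square complex_eq_iff)
  then have "((\<lambda>q. christoffel g q \<i> \<i>) has_derivative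
     (\<lambda>c. Complex ((l1 p * (l1 p * Re c + l2 p * Im c) - l p * d1 c) / (2 * (l p)\<^sup>2))
       ((l p * d2 c - l2 p * (l1 p * Re c + l2 p * Im c)) / (2 * (l p)\<^sup>2)))) (at p)"
    by (rule has_derivative_transform_within_open[OF _ S])
       (simp add: C complex_eq_iff field_simps inner_complex_def)
  note D1 = frechet_derivative_at[OF this, symmetric]
  have "((\<lambda>q. Complex (l2 q / (2 * l q)) (l1 q / (2 * l q))) has_derivative
     (\<lambda>c. Complex ((l p * d2 c - l2 p * (l1 p * Re c + l2 p * Im c)) / (2 * (l p)\<^sup>2))
       ((l p * d1 c - l1 p * (l1 p * Re c + l2 p * Im c)) / (2 * (l p)\<^sup>2)))) (at p)"
    using lp
    by (intro has_derivative_Complex; auto intro!: derivative_eq_intros dl dl1 dl2 S simp: fun_eq_iff field_simps power2_eq_square complex_eq_iff)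
  then have "((\<lambda>q. christoffel g q 1 \<i>) has_derivative
     (\<lambda>c. Complex ((l p * d2 c - l2 p * (l1 p * Re c + l2 p * Im c)) / (2 * (l p)\<^sup>2))
       ((l p * d1 c - l1 p * (l1 p * Re c + l2 p * Im c)) / (2 * (l p)\<^sup>2)))) (at p)"
    by (rule has_derivative_transform_within_open[OF _ S])
       (simp add: C complex_eq_iff field_simps inner_complex_def)
  note D2 = frechet_derivative_at[OF this, symmetric]
  show ?thesis
    unfolding gauss_curvature_def sectional_curvature_def curvature_tensor_def D1 D2 C[OF S(2)] g[OF S(2)]
    using lp by (simp add: inner_complex_def field_simps power2_eq_square power3_eq_cube)
qed

section \<open>Covariant derivatives along a surface\<close>

definition covariant_along ::
  "'a::euclidean_space metric \<Rightarrow> ('c::real_normed_vector \<Rightarrow> 'a) \<Rightarrow> 'c \<Rightarrow> ('c \<Rightarrow> 'a) \<Rightarrow> 'c \<Rightarrow> 'a" where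
  "covariant_along g X c V p = along c V p + christoffel g (X p) (along c X p) (V p)"

lemma covariant_along_H2R:
  "Im (fst (X p)) > 0 \<Longrightarrow> covariant_along H2R_metric X c V p =
    (fst (along c V p) + \<i> * fst (along c X p) * fst (V p) / of_real (Im (fst (X p))), snd (along c V p))"
  by (simp add: covariant_along_def christoffel_H2R_metric prod_eq_iff)

text \<open>
  Compatibility of the connection with the metric; the derivative of the factor \<open>1 / (Im z)\<^sup>2\<close> is
  absorbed by the Christoffel terms.
\<close>

lemma has_derivative_H2R_metric:
  assumes X: "(X has_derivative (\<lambda>c. along c X p)) (at p)"
    and V: "(V has_derivative (\<lambda>c. along c V p)) (at p)"
    and W: "(W has_derivative (\<lambda>c. along c W p)) (at p)"
    and pos: "Im (fst (X p)) > 0"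
  shows "((\<lambda>q. H2R_metric (X q) (V q) (W q)) has_derivative
    (\<lambda>c. H2R_metric (X p) (covariant_along H2R_metric X c V p) (W p)
       + H2R_metric (X p) (V p) (covariant_along H2R_metric X c W p))) (at p)"
proof -
  have "((\<lambda>q. (Re (fst (V q)) * Re (fst (W q)) + Im (fst (V q)) * Im (fst (W q))) / (Im (fst (X q)))\<^sup>2
       + snd (V q) * snd (W q)) has_derivative
    (\<lambda>c. H2R_metric (X p) (covariant_along H2R_metric X c V p) (W p)
       + H2R_metric (X p) (V p) (covariant_along H2R_metric X c W p))) (at p)"
    unfolding covariant_along_H2R[where X=X, OF pos] using pos
    by (auto intro!: derivative_eq_intros V W X simp: fun_eq_iff H2R_metric_def H2_metric_def inner_complex_def
        field_simps power2_eq_square power3_eq_cube)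
  then show ?thesis by (simp add: H2R_metric_def[abs_def] H2_metric_def inner_complex_def)
qed

text \<open>
  The connection has no torsion: the Christoffel term is symmetric, and so is the second derivative.
\<close>

lemma covariant_along_commute:
  assumes "smooth_on S X" "open S" "p \<in> S" "Im (fst (X p)) > 0"
  shows "covariant_along H2R_metric X a (along b X) p = covariant_along H2R_metric X b (along a X) p"
  using assms along_symmetric[OF assms(1-3), of a b] by (simp add: covariant_along_H2R mult_ac)

lemma has_derivative_covariant_along:
  assumes X: "smooth_on S X" and S: "open S" "p \<in> S" and pos: "\<And>q. q \<in> S \<Longrightarrow> Im (fst (X q)) > 0"
    and V: "smooth_on S V"
  shows "((\<lambda>q. covariant_along H2R_metric X b V q) has_derivative
    (\<lambda>a. (fst (along a (along b V) p)
       + \<i> * (fst (along a (along b X) p) * fst (V p) + fst (along b X p) * fst (along a V p)) / of_real (Im (fst (X p)))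
       - \<i> * fst (along b X p) * fst (V p) * of_real (Im (fst (along a X p))) / of_real ((Im (fst (X p)))\<^sup>2),
       snd (along a (along b V) p)))) (at p)"
proof -
  note D = X V smooth_on_along[OF V] smooth_on_along[OF X]
  note D = D[THEN smooth_on_has_derivative, OF S(2)]
  have "((\<lambda>q. (fst (along b V q) + \<i> * fst (along b X q) * fst (V q) / of_real (Im (fst (X q))), snd (along b V q))) has_derivative
    (\<lambda>a. (fst (along a (along b V) p)
       + \<i> * (fst (along a (along b X) p) * fst (V p) + fst (along b X p) * fst (along a V p)) / of_real (Im (fst (X p)))
       - \<i> * fst (along b X p) * fst (V p) * of_real (Im (fst (along a X p))) / of_real ((Im (fst (X p)))\<^sup>2),
       snd (along a (along b V) p)))) (at p)"
    using pos[OF S(2)]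
    by (auto intro!: derivative_eq_intros D simp: fun_eq_iff prod_eq_iff field_simps power2_eq_square)
  then show ?thesis
    by (rule has_derivative_transform_within_open[OF _ S]) (simp add: pos covariant_along_H2R)
qed

text \<open>
  The second derivatives of \<open>X\<close> and \<open>V\<close> cancel by symmetry, and the rest is the curvature tensor: the hyperbolic factor
  turns the horizontal part of \<open>V\<close> by a right angle and scales it by the oriented hyperbolic area of the
  parallelogram spanned by the horizontal parts of \<open>dX(a)\<close> and \<open>dX(b)\<close>.  The sign of this term makes \<open>J\<^sup>2\<close>
  enter the Bochner formula with a plus.
\<close>

lemma covariant_along_commutator:
  assumes X: "smooth_on S X" and S: "open S" "p \<in> S" and pos: "\<And>q. q \<in> S \<Longrightarrow> Im (fst (X q)) > 0"
    and V: "smooth_on S V"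
  shows "covariant_along H2R_metric X a (covariant_along H2R_metric X b V) p
      - covariant_along H2R_metric X b (covariant_along H2R_metric X a V) p
    = (\<i> * of_real (Im (cnj (fst (along a X p)) * fst (along b X p)) / (Im (fst (X p)))\<^sup>2) * fst (V p), 0)"
proof -
  note D = frechet_derivative_at[OF has_derivative_covariant_along[OF X S pos V], symmetric]
  show ?thesis
    using pos[OF S(2)] along_symmetric[OF X S, of a b] along_symmetric[OF V S, of a b]
    by (simp add: covariant_along_H2R D complex_eq_iff field_simps power2_eq_square)
qed

section \<open>Gauss curvature of conformal minimal surfaces\<close>

locale conformal_minimal_surface =
  fixes \<Omega> :: "complex set" and X :: "complex \<Rightarrow> complex \<times> real"
  assumes open_domain: "open \<Omega>"
    and upper: "w \<in> \<Omega> \<Longrightarrow> Im (fst (X w)) > 0"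
    and conformal: "conformal_immersion H2R_metric \<Omega> X"
    and minimal: "minimal_surface H2R_metric \<Omega> X"
begin

abbreviation "Xu \<equiv> along 1 X"
abbreviation "Xv \<equiv> along \<i> X"
abbreviation "g w \<equiv> H2R_metric (X w)"
abbreviation "cov \<equiv> covariant_along H2R_metric X"
text \<open>
  By conformality the squared length of either coordinate field is the conformal factor.
\<close>

abbreviation "l w \<equiv> H2R_metric (X w) (Xu w) (Xu w)"

lemma smooth: "smooth_on \<Omega> X" "smooth_on \<Omega> (along c X)"
  using conformal smooth_on_along by (auto simp: conformal_immersion_def)

lemma along_eq:
  assumes "w \<in> \<Omega>"
  shows "along c X w = Re c *\<^sub>R Xu w + Im c *\<^sub>R Xv w"
proof -
  have "linear (\<lambda>c. along c X w)"
    using has_derivative_linear[OF smooth_on_has_derivative[OF smooth(1) assms]] .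
  from linear_add[OF this, of "Re c *\<^sub>R 1" "Im c *\<^sub>R \<i>"] linear_cmul[OF this]
  have "along (Re c *\<^sub>R 1 + Im c *\<^sub>R \<i>) X w = Re c *\<^sub>R Xu w + Im c *\<^sub>R Xv w" by simp
  moreover have "Re c *\<^sub>R 1 + Im c *\<^sub>R \<i> = c" by (simp add: complex_eq_iff)
  ultimately show ?thesis by simp
qed

lemma induced_metric_eq:
  assumes "w \<in> \<Omega>"
  shows "l w > 0" "induced_metric H2R_metric X w a b = l w * (a \<bullet> b)"
proof -
  obtain c where c: "c > 0" "\<And>a b. induced_metric H2R_metric X w a b = c * (a \<bullet> b)"
    using conformal assms unfolding conformal_immersion_def by blast
  have "l w = c" using c(2)[of 1 1] by (simp add: induced_metric_def inner_complex_def)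
  then show "l w > 0" "induced_metric H2R_metric X w a b = l w * (a \<bullet> b)" using c by auto
qed

lemma frame:
  assumes "w \<in> \<Omega>"
  shows "g w (Xv w) (Xv w) = l w" "g w (Xu w) (Xv w) = 0" "g w (Xv w) (Xu w) = 0"
  using induced_metric_eq(2)[OF assms, of \<i> \<i>] induced_metric_eq(2)[OF assms, of 1 \<i>]
    induced_metric_eq(2)[OF assms, of \<i> 1]
  by (simp_all add: induced_metric_def inner_complex_def)

lemma tangent_plane_eq:
  assumes w: "w \<in> \<Omega>"
  shows "tangent_plane X w = {r *\<^sub>R Xu w + s *\<^sub>R Xv w |r s. True}"
proof -
  have "r *\<^sub>R Xu w + s *\<^sub>R Xv w \<in> range (frechet_derivative X (at w))" for r s
    by (rule image_eqI[of _ _ "Complex r s"]) (simp_all add: along_eq[OF w, of "Complex r s"])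
  then show ?thesis unfolding tangent_plane_def using along_eq[OF w] by blast
qed

text \<open>
  By conformality \<open>Xu\<close> and \<open>Xv\<close> are an orthogonal basis of the tangent plane with common squared
  length \<open>l\<close>, so the tangential projection has the usual Fourier coefficients.
\<close>

lemma normal_part_eq:
  assumes w: "w \<in> \<Omega>"
  shows "normal_part H2R_metric X w a = a - (g w a (Xu w) / l w) *\<^sub>R Xu w - (g w a (Xv w) / l w) *\<^sub>R Xv w"
    (is "_ = ?n")
proof -
  note lw = induced_metric_eq(1)[OF w]
  have n: "g w ?n (Xu w) = 0" "g w ?n (Xv w) = 0"
    using lw by (simp_all add: H2R_metric_algebra frame[OF w])
  show ?thesis unfolding normal_part_def
  proof (rule the_equality)
    have "a - ?n = (g w a (Xu w) / l w) *\<^sub>R Xu w + (g w a (Xv w) / l w) *\<^sub>R Xv w" by simp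
    then have "a - ?n \<in> tangent_plane X w" unfolding tangent_plane_eq[OF w] by blast
    moreover have "g w ?n b = 0" if b: "b \<in> tangent_plane X w" for b
    proof -
      obtain r s where "b = r *\<^sub>R Xu w + s *\<^sub>R Xv w" using b unfolding tangent_plane_eq[OF w] by blast
      then show ?thesis using n by (simp add: H2R_metric_algebra(5,8))
    qed
    ultimately show "a - ?n \<in> tangent_plane X w \<and> (\<forall>b\<in>tangent_plane X w. g w ?n b = 0)" by blast
  next
    fix m assume m: "a - m \<in> tangent_plane X w \<and> (\<forall>b\<in>tangent_plane X w. g w m b = 0)"
    then obtain r s where rs: "a - m = r *\<^sub>R Xu w + s *\<^sub>R Xv w"
      unfolding tangent_plane_eq[OF w] by blast
    have a: "a = m + r *\<^sub>R Xu w + s *\<^sub>R Xv w" using rs by (simp add: algebra_simps)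
    have "Xu w \<in> tangent_plane X w" "Xv w \<in> tangent_plane X w"
      by (simp_all add: tangent_plane_def)
    with m have "g w m (Xu w) = 0" "g w m (Xv w) = 0" by blast+
    then have "g w a (Xu w) = r * l w" "g w a (Xv w) = s * l w"
      unfolding a by (simp_all add: H2R_metric_algebra frame[OF w])
    then show "m = ?n" using a lw by simp
  qed
qed

lemma has_derivative_frame_metric:
  assumes "w \<in> \<Omega>"
  shows "((\<lambda>q. g q (along a X q) (along b X q)) has_derivative
    (\<lambda>c. g w (cov c (along a X) w) (along b X w) + g w (along a X w) (cov c (along b X) w))) (at w)"
  using smooth[THEN smooth_on_has_derivative, OF assms] 
  by (intro has_derivative_H2R_metric upper assms)

text \<open>
  Differentiating \<open>|Xv|\<^sup>2 = |Xu|\<^sup>2\<close> and \<open>\<langle>Xu, Xv\<rangle> = 0\<close>.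
\<close>

lemma derivative_conformal_relations:
  assumes w: "w \<in> \<Omega>"
  shows "g w (cov c Xv w) (Xv w) = g w (cov c Xu w) (Xu w)"
    and "g w (cov c Xu w) (Xv w) = - g w (cov c Xv w) (Xu w)"
proof -
  have "(l has_derivative (\<lambda>c. g w (cov c Xv w) (Xv w) + g w (Xv w) (cov c Xv w))) (at w)"
    by (rule has_derivative_transform_within_open[OF has_derivative_frame_metric[OF w] open_domain w])
       (rule frame)
  from has_derivative_unique[OF this has_derivative_frame_metric[OF w]]
  have "g w (cov c Xv w) (Xv w) + g w (Xv w) (cov c Xv w)
      = g w (cov c Xu w) (Xu w) + g w (Xu w) (cov c Xu w)" by meson
  then show "g w (cov c Xv w) (Xv w) = g w (cov c Xu w) (Xu w)"
    by (simp add: H2R_metric_commute[of "X w" "Xu w"] H2R_metric_commute[of "X w" "Xv w"])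
  have "((\<lambda>_. 0) has_derivative (\<lambda>c. g w (cov c Xu w) (Xv w) + g w (Xu w) (cov c Xv w))) (at w)"
    by (rule has_derivative_transform_within_open[OF has_derivative_frame_metric[OF w] open_domain w])
       (rule frame)
  from has_derivative_unique[OF this has_derivative_const]
  have "g w (cov c Xu w) (Xv w) + g w (Xu w) (cov c Xv w) = 0" by meson
  then show "g w (cov c Xu w) (Xv w) = - g w (cov c Xv w) (Xu w)"
    by (simp add: H2R_metric_commute[of "X w" "Xu w"])
qed

lemma cov_commute: "w \<in> \<Omega> \<Longrightarrow> cov \<i> Xu w = cov 1 Xv w"
  using covariant_along_commute[OF smooth(1) open_domain _ upper] .

text \<open>
  Minimality says that the normal part vanishes.  The tangential part vanishes for every conformal
  immersion, by the differentiated conformality relations.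
\<close>

lemma harmonic:
  assumes w: "w \<in> \<Omega>"
  shows "cov 1 Xu w + cov \<i> Xv w = 0"
proof -
  have lw: "l w > 0" by (rule induced_metric_eq(1)[OF w])
  have "second_fundamental_form H2R_metric X w a b = normal_part H2R_metric X w (cov a (along b X) w)" for a b
    by (simp add: second_fundamental_form_def covariant_along_def)
  then have "(1 / (2 * (l w)\<^sup>2)) *\<^sub>R (l w *\<^sub>R normal_part H2R_metric X w (cov 1 Xu w)
      + l w *\<^sub>R normal_part H2R_metric X w (cov \<i> Xv w)) = 0"
    using minimal w unfolding minimal_surface_def mean_curvature_vector_def Let_def
    by (auto simp: induced_metric_eq(2)[OF w] inner_complex_def power2_eq_square)
  then have "normal_part H2R_metric X w (cov 1 Xu w) + normal_part H2R_metric X w (cov \<i> Xv w) = 0"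
    using lw by (simp flip: scaleR_add_right)
  moreover have "g w (cov 1 Xu w) (Xu w) + g w (cov \<i> Xv w) (Xu w) = 0"
    using derivative_conformal_relations[OF w, of 1] derivative_conformal_relations[OF w, of \<i>] cov_commute[OF w] by simp
  moreover have "g w (cov 1 Xu w) (Xv w) + g w (cov \<i> Xv w) (Xv w) = 0"
    using derivative_conformal_relations[OF w, of 1] derivative_conformal_relations[OF w, of \<i>] cov_commute[OF w] by simp
  ultimately show ?thesis
    unfolding normal_part_eq[OF w]
    by (simp add: algebra_simps flip: scaleR_add_left add_divide_distrib add.assoc) 
qed

text \<open>
  The Jacobian determinant of the horizontal part with respect to the hyperbolic area.
\<close>

abbreviation "J w \<equiv> Im (cnj (fst (Xu w)) * fst (Xv w)) / (Im (fst (X w)))\<^sup>2"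

text \<open>
  The Gauss equation reads \<open>K = - (J/l)\<^sup>2 + det A\<close>, where \<open>det A \<le> 0\<close> since the shape operator \<open>A\<close> of a minimal
  surface is symmetric and has no trace.  In the Bochner formula for \<open>\<Delta>l\<close> the term
  \<open>- det A\<close> appears, up to a positive factor, as the sum of the defects in Bessel's inequality for \<open>P\<close> and \<open>Q\<close>.
\<close>

lemma gauss_curvature_le:
  assumes w: "w \<in> \<Omega>"
  shows "gauss_curvature (induced_metric H2R_metric X) w \<le> - (J w / l w)\<^sup>2"
proof -
  \<comment> \<open>The partial derivatives of \<open>l\<close>.  Harmonicity replaces \<open>cov 1 Xu\<close> by \<open>- cov \<i> Xv\<close> in the first one, so that
    the second derivatives of \<open>l\<close> differentiate \<open>Xv\<close> in the orders \<open>1, \<i>\<close> and \<open>\<i>, 1\<close> and combine into a commutator.\<close>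
  define l1 where "l1 q = -2 * g q (cov \<i> Xv q) (Xu q)" for q
  define l2 where "l2 q = 2 * g q (cov 1 Xv q) (Xu q)" for q
  define P where "P = cov 1 Xu w"
  define Q where "Q = cov 1 Xv w"
  have R: "cov \<i> Xv q = - cov 1 Xu q" if "q \<in> \<Omega>" for q
    using harmonic[OF that] by (simp add: eq_neg_iff_add_eq_0 add.commute)
  have dl: "(l has_derivative (\<lambda>c. l1 q * Re c + l2 q * Im c)) (at q)" if q: "q \<in> \<Omega>" for q
  proof -
    have eq: "(\<lambda>c. g q (cov c Xu q) (Xu q) + g q (Xu q) (cov c Xu q)) = (\<lambda>c. 2 * g q (cov c Xu q) (Xu q))"
      by (simp add: H2R_metric_commute[of "X q" "Xu q"])
    have d: "(l has_derivative (\<lambda>c. 2 * g q (cov c Xu q) (Xu q))) (at q)"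
      using has_derivative_frame_metric[OF q, of 1 1] unfolding eq .
    have lin: "linear (\<lambda>c. 2 * g q (cov c Xu q) (Xu q))" using d by (rule has_derivative_linear)
    have "2 * g q (cov c Xu q) (Xu q) = l1 q * Re c + l2 q * Im c" for c
    proof -
      have "2 * g q (cov (Re c *\<^sub>R 1 + Im c *\<^sub>R \<i>) Xu q) (Xu q)
        = Re c * (2 * g q (cov 1 Xu q) (Xu q)) + Im c * (2 * g q (cov \<i> Xu q) (Xu q))"
        using linear_add[OF lin, of "Re c *\<^sub>R 1" "Im c *\<^sub>R \<i>"] linear_cmul[OF lin] by simp
      moreover have "Re c *\<^sub>R 1 + Im c *\<^sub>R \<i> = c" by (simp add: complex_eq_iff)
      ultimately show ?thesis
        by (simp add: l1_def l2_def R[OF q] cov_commute[OF q] H2R_metric_algebra mult.commute)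
    qed
    then show ?thesis using d by simp
  qed
  note D = has_derivative_covariant_along[OF smooth(1) open_domain w upper smooth(2)]
  have DC: "((\<lambda>q. cov a (along b X) q) has_derivative (\<lambda>c. along c (cov a (along b X)) w)) (at w)" for a b
    using D[of a b] frechet_derivative_at[OF D[of a b]] by simp
  have dR: "((\<lambda>q. g q (cov a (along b X) q) (Xu q)) has_derivative
     (\<lambda>c. g w (cov c (cov a (along b X)) w) (Xu w) + g w (cov a (along b X) w) (cov c Xu w))) (at w)" for a b
    using smooth[THEN smooth_on_has_derivative, OF w] by (intro has_derivative_H2R_metric DC upper w)
  have d1: "(l1 has_derivative (\<lambda>c. -2 * (g w (cov c (cov \<i> Xv) w) (Xu w) + g w (cov \<i> Xv w) (cov c Xu w)))) (at w)"
    unfolding l1_def[abs_def] by (intro has_derivative_mult_right dR)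
  have d2: "(l2 has_derivative (\<lambda>c. 2 * (g w (cov c (cov 1 Xv) w) (Xu w) + g w (cov 1 Xv w) (cov c Xu w)))) (at w)"
    unfolding l2_def[abs_def] by (intro has_derivative_mult_right dR)
  have lap: "-2 * (g w (cov 1 (cov \<i> Xv) w) (Xu w) + g w (cov \<i> Xv w) (cov 1 Xu w))
      + 2 * (g w (cov \<i> (cov 1 Xv) w) (Xu w) + g w (cov 1 Xv w) (cov \<i> Xu w))
     = 2 * g w P P + 2 * g w Q Q + 2 * (J w)\<^sup>2" (is "?L = _")
  proof -
    have comm: "cov 1 (cov \<i> Xv) w - cov \<i> (cov 1 Xv) w = (\<i> * of_real (J w) * fst (Xv w), 0)"
      by (rule covariant_along_commutator[OF smooth(1) open_domain w upper smooth(2)])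
    have "?L = 2 * g w P P + 2 * g w Q Q - 2 * g w (cov 1 (cov \<i> Xv) w - cov \<i> (cov 1 Xv) w) (Xu w)"
      by (simp add: P_def Q_def R[OF w] cov_commute[OF w] H2R_metric_algebra)
    also have "g w (cov 1 (cov \<i> Xv) w - cov \<i> (cov 1 Xv) w) (Xu w) = - (J w)\<^sup>2"
      unfolding comm
      using upper[OF w] by (simp add: H2R_metric_def H2_metric_def inner_complex_def field_simps power2_eq_square)
    finally show ?thesis by simp
  qed
  have lw: "l w > 0" by (rule induced_metric_eq(1)[OF w])
  have K: "gauss_curvature (induced_metric H2R_metric X) w =
     - (l w * (2 * g w P P + 2 * g w Q Q + 2 * (J w)\<^sup>2) - ((l1 w)\<^sup>2 + (l2 w)\<^sup>2)) / (2 * (l w)^3)"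
    using gauss_curvature_conformal[OF open_domain w induced_metric_eq(2) induced_metric_eq(1) dl d1 d2]
    unfolding lap .
  have "(l1 w / 2)\<^sup>2 + (l2 w / 2)\<^sup>2 \<le> l w * g w P P" "(l1 w / 2)\<^sup>2 + (l2 w / 2)\<^sup>2 \<le> l w * g w Q Q"
  proof -
    have P: "g w P (Xu w) = l1 w / 2" "g w P (Xv w) = - l2 w / 2"
      and Q: "g w Q (Xu w) = l2 w / 2" "g w Q (Xv w) = l1 w / 2"
      using derivative_conformal_relations[OF w, of 1]
      by (simp_all add: P_def Q_def l1_def l2_def R[OF w] H2R_metric_algebra)
    show "(l1 w / 2)\<^sup>2 + (l2 w / 2)\<^sup>2 \<le> l w * g w P P" "(l1 w / 2)\<^sup>2 + (l2 w / 2)\<^sup>2 \<le> l w * g w Q Q"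
      using bessel_H2R_metric[OF lw refl frame(1,2)[OF w], of P] bessel_H2R_metric[OF lw refl frame(1,2)[OF w], of Q]
      unfolding P Q by simp_all
  qed
  then have "2 * l w * (J w)\<^sup>2 \<le> l w * (2 * g w P P + 2 * g w Q Q + 2 * (J w)\<^sup>2) - ((l1 w)\<^sup>2 + (l2 w)\<^sup>2)"
    by (simp add: algebra_simps power_divide)
  then have "2 * l w * (J w)\<^sup>2 / (2 * (l w)^3) \<le> (l w * (2 * g w P P + 2 * g w Q Q + 2 * (J w)\<^sup>2) - ((l1 w)\<^sup>2 + (l2 w)\<^sup>2)) / (2 * (l w)^3)"
    using lw by (intro divide_right_mono) auto
  moreover have cancel: "2 * x * y\<^sup>2 / (2 * x^3) = (y / x)\<^sup>2" if "x > 0" for x y :: real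
    using that by (simp add: field_simps power2_eq_square power3_eq_cube)
  have "2 * l w * (J w)\<^sup>2 / (2 * (l w)^3) = (J w / l w)\<^sup>2"
    by (rule cancel[OF lw])
  ultimately show ?thesis unfolding K by linarith
qed

lemma flat_imp_parallel:
  assumes "w \<in> \<Omega>" "gauss_curvature (induced_metric H2R_metric X) w = 0"
  shows "Im (cnj (fst (Xu w)) * fst (Xv w)) = 0"
  using gauss_curvature_le[OF assms(1)] assms(2) upper[OF assms(1)] induced_metric_eq(1)[OF assms(1)] by simp

lemma flat_imp_vertical:
  assumes w: "w \<in> \<Omega>" "gauss_curvature (induced_metric H2R_metric X) w = 0"
  shows "vertical_plane (tangent_plane X w)"
proof -
  define a where "a = fst (Xu w)"
  define b where "b = fst (Xv w)"
  have par: "Im (cnj a * b) = 0" using flat_imp_parallel[OF w] by (simp add: a_def b_def)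
  have "\<exists>r s. (r, s) \<noteq> (0, 0) \<and> r *\<^sub>R a + s *\<^sub>R b = 0"
  proof (cases "a = 0")
    case True
    then show ?thesis by (intro exI[of _ 1] exI[of _ 0]) simp
  next
    case False
    define m where "m = Re (cnj a * b)"
    have "(cmod a)\<^sup>2 *\<^sub>R b = a * (cnj a * b)"
      by (simp add: scaleR_conv_of_real complex_norm_square del: of_real_power)
    also have "cnj a * b = of_real m"
      using par by (simp add: complex_eq_iff m_def)
    finally have "(- m) *\<^sub>R a + (cmod a)\<^sup>2 *\<^sub>R b = 0"
      by (simp add: scaleR_conv_of_real mult.commute)
    then show ?thesis using False by (intro exI[of _ "- m"] exI[of _ "(cmod a)\<^sup>2"]) simp
  qed
  then obtain r s where rs: "(r, s) \<noteq> (0, 0)" "r *\<^sub>R a + s *\<^sub>R b = 0" by blast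
  define V where "V = r *\<^sub>R Xu w + s *\<^sub>R Xv w"
  have "g w V V = l w * (r\<^sup>2 + s\<^sup>2)"
    by (simp add: V_def H2R_metric_algebra frame[OF w(1)] algebra_simps power2_eq_square)
  moreover have "r\<^sup>2 + s\<^sup>2 > 0" using rs(1) by (simp add: sum_power2_gt_zero_iff)
  ultimately have "g w V V > 0" using induced_metric_eq(1)[OF w(1)] by simp
  then have "V \<noteq> 0" by (auto simp: H2R_metric_algebra)
  moreover have V1: "fst V = 0" using rs(2) by (simp add: V_def a_def b_def)
  ultimately have V2: "snd V \<noteq> 0" by (auto simp: prod_eq_iff)
  have "(0, 1) = (1 / snd V) *\<^sub>R V" using V1 V2 by (simp add: prod_eq_iff)
  also have "\<dots> = (r / snd V) *\<^sub>R Xu w + (s / snd V) *\<^sub>R Xv w" 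
    by (simp add: V_def scaleR_add_right)
  finally show ?thesis unfolding vertical_plane_def tangent_plane_eq[OF w(1)] by blast
qed

end

section \<open>Geodesics of the hyperbolic plane\<close>

lemma H2_geodesic_vertical_line: "H2_geodesic {z. Re z = x \<and> Im z > 0}"
proof -
  define \<gamma> where "\<gamma> t = of_real x + \<i> * of_real (exp t)" for t
  have "geodesic H2_metric H2 \<gamma>"
    unfolding geodesic_def
  proof (intro exI[of _ "\<lambda>t. \<i> * of_real (exp t)"] allI conjI)
    fix t
    have im: "Im (\<gamma> t) = exp t" by (simp add: \<gamma>_def)
    show "\<gamma> t \<in> H2" by (simp add: H2_def im)
    show "\<i> * of_real (exp t) \<noteq> 0" by simp
    show "(\<gamma> has_vector_derivative \<i> * of_real (exp t)) (at t)"
      unfolding \<gamma>_def by (auto intro!: derivative_eq_intros has_vector_derivative_real_field)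
    have "((\<lambda>t. \<i> * of_real (exp t)) has_vector_derivative \<i> * of_real (exp t)) (at t)"
      by (auto intro!: derivative_eq_intros)
    then show "((\<lambda>t. \<i> * of_real (exp t)) has_vector_derivative
       - christoffel H2_metric (\<gamma> t) (\<i> * of_real (exp t)) (\<i> * of_real (exp t))) (at t)"
      using im by (simp add: christoffel_H2_metric)
  qed
  moreover have "range \<gamma> = {z. Re z = x \<and> Im z > 0}"
  proof (intro set_eqI iffI)
    fix z assume "z \<in> {z. Re z = x \<and> Im z > 0}"
    then show "z \<in> range \<gamma>" by (intro image_eqI[of _ _ "ln (Im z)"]) (auto simp: \<gamma>_def complex_eq_iff)
  qed (auto simp: \<gamma>_def)
  ultimately show ?thesis unfolding H2_geodesic_def by metis
qed

text \<open>
  The half-circle is run through at constant speed \<open>1\<close> as \<open>x + r (tanh t + \<i> / cosh t)\<close>.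
\<close>

lemma H2_geodesic_half_circle:
  assumes r: "r > 0"
  shows "H2_geodesic {z. cmod (z - of_real x) = r \<and> Im z > 0}"
proof -
  define \<gamma> where "\<gamma> t = Complex (x + r * sinh t / cosh t) (r / cosh t)" for t
  define \<gamma>' where "\<gamma>' t = Complex (r / (cosh t)\<^sup>2) (- r * sinh t / (cosh t)\<^sup>2)" for t
  have pos: "cosh t > 0" for t :: real by simp
  have nz: "cosh t \<noteq> 0" for t :: real using pos[of t] by linarith
  have sq: "(sinh t)\<^sup>2 = (cosh t)\<^sup>2 - 1" for t :: real using cosh_square_eq[of t] by simp
  have sq2: "r * (cosh t * cosh t) = r + r * (sinh t * sinh t)" for t :: real
    using sq[of t] by algebra
  \<comment> \<open>Minus the Christoffel term of the velocity, with \<open>c\<close> and \<open>s\<close> for \<open>cosh t\<close> and \<open>sinh t\<close>.\<close>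
  have acceleration: "- (\<i> * Complex (r / c\<^sup>2) (- r * s / c\<^sup>2) * Complex (r / c\<^sup>2) (- r * s / c\<^sup>2) / of_real (r / c))
      = Complex (- 2 * r * s / c ^ 3) ((r * s\<^sup>2 - r) / c ^ 3)" if "r \<noteq> 0" "c \<noteq> 0" for s c :: real
    unfolding complex_eq_iff Re_divide_of_real Im_divide_of_real uminus_complex.sel times_complex.sel complex.sel
    using that by (simp add: field_simps power2_eq_square power3_eq_cube)
  have vec: "((\<lambda>t. Complex (u t) (v t)) has_vector_derivative Complex u' v') (at t)"
    if "(u has_real_derivative u') (at t)" "(v has_real_derivative v') (at t)" for u v u' v' t
    using that unfolding Complex_eq 
    by (auto intro!: derivative_eq_intros has_vector_derivative_of_real
        simp: has_real_derivative_iff_has_vector_derivative)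
  have "geodesic H2_metric H2 \<gamma>"
    unfolding geodesic_def
  proof (intro exI[of _ \<gamma>'] allI conjI)
    fix t
    have im: "Im (\<gamma> t) = r / cosh t" by (simp add: \<gamma>_def)
    show "\<gamma> t \<in> H2" using r by (simp add: H2_def im)
    show "\<gamma>' t \<noteq> 0" using r nz[of t] by (simp add: \<gamma>'_def complex_eq_iff)
    show "(\<gamma> has_vector_derivative \<gamma>' t) (at t)"
      unfolding \<gamma>_def \<gamma>'_def
      by (rule vec)
        (use nz sq2 in \<open>auto intro!: derivative_eq_intros simp: field_simps power2_eq_square\<close>)
    have "(\<gamma>' has_vector_derivative Complex (- 2 * r * sinh t / (cosh t)^3)
       ((2 * r * (sinh t)\<^sup>2 - r * (cosh t)\<^sup>2) / (cosh t)^3)) (at t)"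
      unfolding \<gamma>'_def
      by (rule vec) (use nz in \<open>auto intro!: derivative_eq_intros simp: field_simps power2_eq_square power3_eq_cube\<close>)
    moreover have chr: "christoffel H2_metric (\<gamma> t) u v = \<i> * u * v / of_real (r / cosh t)" for u v
      using christoffel_H2_metric[of "\<gamma> t"] r pos[of t] unfolding im by simp
    have "- christoffel H2_metric (\<gamma> t) (\<gamma>' t) (\<gamma>' t) = Complex (- 2 * r * sinh t / (cosh t)^3)
       ((r * (sinh t)\<^sup>2 - r) / (cosh t)^3)"
      unfolding chr \<gamma>'_def using r nz[of t] by (intro acceleration) auto
    moreover have "2 * r * (sinh t)\<^sup>2 - r * (cosh t)\<^sup>2 = r * (sinh t)\<^sup>2 - r"
      using sq2[of t] by (simp add: power2_eq_square)
    ultimately show "(\<gamma>' has_vector_derivative - christoffel H2_metric (\<gamma> t) (\<gamma>' t) (\<gamma>' t)) (at t)" by simp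
  qed
  moreover have "range \<gamma> = {z. cmod (z - of_real x) = r \<and> Im z > 0}"
  proof (intro set_eqI iffI)
    fix z assume "z \<in> range \<gamma>"
    then obtain t where z: "z = \<gamma> t" by blast
    have "(cmod (z - of_real x))\<^sup>2 = r\<^sup>2"
      unfolding cmod_power2 z \<gamma>_def using nz[of t]
      by (simp add: power_divide power_mult_distrib sq field_simps)
    then show "z \<in> {z. cmod (z - of_real x) = r \<and> Im z > 0}"
      using r by (simp add: power2_eq_iff_nonneg) (simp add: z \<gamma>_def)
  next
    fix z assume z: "z \<in> {z. cmod (z - of_real x) = r \<and> Im z > 0}"
    \<comment> \<open>On the parametrized half-circle \<open>sinh t\<close> is the quotient of \<open>Re z - x\<close> and \<open>Im z\<close>.\<close>
    define t where "t = arsinh ((Re z - x) / Im z)"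
    have sh: "sinh t = (Re z - x) / Im z" by (simp add: t_def)
    have "(Re z - x)\<^sup>2 + (Im z)\<^sup>2 = r\<^sup>2" using z cmod_power2[of "z - of_real x"] by simp
    then have "(cosh t)\<^sup>2 = (r / Im z)\<^sup>2"
      using z by (simp add: cosh_square_eq sh field_simps)
    then have ch: "cosh t = r / Im z" using z r by (simp add: power2_eq_iff_nonneg)
    have "z = \<gamma> t" using z r by (simp add: \<gamma>_def sh ch complex_eq_iff)
    then show "z \<in> range \<gamma>" by blast
  qed
  ultimately show ?thesis unfolding H2_geodesic_def by metis
qed

text \<open>
  The equation describes a circle with centre \<open>b / a\<close> on the real axis, or a vertical line if \<open>a = 0\<close>.
  The radius is positive because \<open>M\<close> has a point, which lies off the real axis.
\<close>

lemma subset_H2_geodesic: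
  assumes M: "M \<subseteq> H2" "M \<noteq> {}" and nz: "(a, b) \<noteq> (0, 0)"
    and eq: "\<And>z. z \<in> M \<Longrightarrow> a * (cmod z)\<^sup>2 - 2 * b * Re z + c = 0"
  shows "\<exists>\<Gamma>. H2_geodesic \<Gamma> \<and> M \<subseteq> \<Gamma>"
proof (cases "a = 0")
  case True
  then have "Re z = c / (2 * b)" if "z \<in> M" for z using eq[OF that] nz by (simp add: field_simps)
  then show ?thesis using M H2_geodesic_vertical_line[of "c / (2 * b)"] by (auto simp: H2_def)
next
  case False
  have sq: "(cmod (z - of_real (b / a)))\<^sup>2 = (b\<^sup>2 - a * c) / a\<^sup>2" if "z \<in> M" for z
  proof -
    have c: "c = 2 * b * Re z - a * ((Re z)\<^sup>2 + (Im z)\<^sup>2)" using eq[OF that] by (simp add: cmod_power2)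
    have "(cmod (z - of_real (b / a)))\<^sup>2 = (Re z - b / a)\<^sup>2 + (Im z)\<^sup>2" unfolding cmod_power2 by simp
    then show ?thesis unfolding c using False by (simp add: field_simps power2_eq_square)
  qed
  obtain z0 where z0: "z0 \<in> M" using M by blast
  define r where "r = cmod (z0 - of_real (b / a))"
  have "Im z0 > 0" using z0 M by (auto simp: H2_def)
  then have r: "r > 0" by (auto simp: r_def complex_eq_iff)
  have "cmod (z - of_real (b / a)) = r" if "z \<in> M" for z
    unfolding r_def by (rule power2_eq_imp_eq) (simp_all only: sq[OF that] sq[OF z0] norm_ge_zero)
  then show ?thesis using M H2_geodesic_half_circle[OF r, of "b / a"] by (auto simp: H2_def)
qed

text \<open>
  Where \<open>\<omega>\<close> is the differential of a function \<open>\<tau>\<close>, the hypotheses say that \<open>h\<close> is a geodesic with velocity \<open>G\<close>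
  composed with \<open>\<tau>\<close>.  The functions \<open>A\<close>, \<open>B\<close>, \<open>C\<close> are the scalar products of \<open>G\<close> with the Killing fields \<open>1\<close>, \<open>z\<close>, \<open>z\<^sup>2\<close>,
  which a geodesic conserves, and the equation \<open>A |h|\<^sup>2 - 2 B Re h + C = 0\<close> holds identically.
\<close>

lemma image_subset_H2_geodesic:
  fixes h G :: "complex \<Rightarrow> complex" and \<omega> :: "complex \<Rightarrow> complex \<Rightarrow> real"
  assumes S: "open S" "connected S" "S \<noteq> {}" and h: "\<And>w. w \<in> S \<Longrightarrow> Im (h w) > 0" 
    and nz: "\<And>w. w \<in> S \<Longrightarrow> G w \<noteq> 0"
    and dh: "\<And>w. w \<in> S \<Longrightarrow> (h has_derivative (\<lambda>c. G w * of_real (\<omega> w c))) (at w)"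
    and dG: "\<And>w. w \<in> S \<Longrightarrow> (G has_derivative (\<lambda>c. - christoffel H2_metric (h w) (G w) (G w) * of_real (\<omega> w c))) (at w)"
  shows "\<exists>\<Gamma>. H2_geodesic \<Gamma> \<and> h ` S \<subseteq> \<Gamma>"
proof -
  have dG': "(G has_derivative (\<lambda>c. - \<i> * (G w)\<^sup>2 / of_real (Im (h w)) * of_real (\<omega> w c))) (at w)" if "w \<in> S" for w
    using dG[OF that] h[OF that] by (simp add: christoffel_H2_metric power2_eq_square mult.assoc)
  define A where "A w = Re (G w) / (Im (h w))\<^sup>2" for w
  define B where "B w = Re (cnj (G w) * h w) / (Im (h w))\<^sup>2" for w
  define C where "C w = Re (cnj (G w) * (h w)\<^sup>2) / (Im (h w))\<^sup>2" for w
  have dA: "(A has_derivative (\<lambda>c. 0)) (at w)" if "w \<in> S" for w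
    unfolding A_def using h[OF that]
    by (auto intro!: derivative_eq_intros dh dG' that simp: fun_eq_iff field_simps power2_eq_square)
  have dB: "(B has_derivative (\<lambda>c. 0)) (at w)" if "w \<in> S" for w
    unfolding B_def using h[OF that]
    by (auto intro!: derivative_eq_intros dh dG' that simp: fun_eq_iff field_simps power2_eq_square)
  have dC: "(C has_derivative (\<lambda>c. 0)) (at w)" if "w \<in> S" for w
    unfolding C_def using h[OF that]
    by (auto intro!: derivative_eq_intros dh dG' that simp: fun_eq_iff field_simps power2_eq_square)
  obtain w0 where w0: "w0 \<in> S" using S by blast
  note const = has_derivative_zero_unique_connected[OF S(1,2) _ _ w0]
  show ?thesis
  proof (rule subset_H2_geodesic)
    show "h ` S \<subseteq> H2" "h ` S \<noteq> {}" using h w0 by (auto simp: H2_def)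
    show "(A w0, B w0) \<noteq> (0, 0)"
      using nz[OF w0] h[OF w0] by (auto simp: A_def B_def complex_eq_iff)
    fix z assume "z \<in> h ` S"
    then obtain w where w: "w \<in> S" "z = h w" by blast
    have "A w * (cmod z)\<^sup>2 - 2 * B w * Re z + C w = 0"
      unfolding A_def B_def C_def w(2) cmod_power2 using h[OF w(1)]
      by (simp add: field_simps power2_eq_square)
    then show "A w0 * (cmod z)\<^sup>2 - 2 * B w0 * Re z + C w0 = 0"
      using const[OF dA w(1)] const[OF dB w(1)] const[OF dC w(1)] by simp
  qed
qed

section \<open>Flat minimal surfaces\<close>

text \<open>
  Here \<open>a\<close>, \<open>b\<close> are the partial derivatives of the horizontal part and \<open>s\<close>, \<open>t\<close> those of the height; the hypotheses
  are conformality and parallelism of \<open>a\<close> and \<open>b\<close>.  Parallelism and the orthogonality relation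
  fix the product \<open>|a|\<^sup>2 |b|\<^sup>2 = (s t)\<^sup>2\<close> when lengths are scaled by \<open>y\<close>, while equality of
  lengths fixes the difference \<open>|a|\<^sup>2 - |b|\<^sup>2 = t\<^sup>2 - s\<^sup>2\<close>.  So \<open>|a| = |t|\<close> and \<open>|b| = |s|\<close>: in the
  direction of \<open>a\<close> and \<open>b\<close>, the horizontal part behaves like a harmonic conjugate of the height.
\<close>

lemma conformal_parallel_pair:
  fixes a b :: complex and s t y m :: real
  assumes y: "y > 0" and l: "m > 0"
    and a: "(cmod a)\<^sup>2 / y\<^sup>2 + s\<^sup>2 = m" and b: "(cmod b)\<^sup>2 / y\<^sup>2 + t\<^sup>2 = m"
    and ab: "Re (cnj a * b) / y\<^sup>2 + s * t = 0" and par: "Im (cnj a * b) = 0"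
  shows "cmod a = y * \<bar>t\<bar>" "cmod b = y * \<bar>s\<bar>" "s\<^sup>2 + t\<^sup>2 = m" "s *\<^sub>R a + t *\<^sub>R b = 0"
proof -
  \<comment> \<open>The defect from the asserted length, which turns out to be a root of \<open>d (s\<^sup>2 + t\<^sup>2 + d) = 0\<close> with \<open>s\<^sup>2 + t\<^sup>2 + d = m > 0\<close>.\<close>
  define d where "d = (cmod a)\<^sup>2 / y\<^sup>2 - t\<^sup>2"
  have A: "(cmod a)\<^sup>2 = (t\<^sup>2 + d) * y\<^sup>2" using y by (simp add: d_def field_simps)
  have sd: "s\<^sup>2 + d = m - t\<^sup>2" using a by (simp add: d_def)
  have B: "(cmod b)\<^sup>2 = (s\<^sup>2 + d) * y\<^sup>2" unfolding sd using y b by (simp add: field_simps)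
  have re: "Re (cnj a * b) = - s * t * y\<^sup>2" using y ab by (simp add: field_simps)
  have "(cmod a)\<^sup>2 * (cmod b)\<^sup>2 = (cmod (cnj a * b))\<^sup>2" by (simp add: norm_mult power_mult_distrib)
  also have "\<dots> = (s * t * y\<^sup>2)\<^sup>2" unfolding cmod_power2 par re by simp
  finally have "((t\<^sup>2 + d) * (s\<^sup>2 + d) - (s * t)\<^sup>2) * (y\<^sup>2)\<^sup>2 = 0"
    unfolding A B by (simp add: algebra_simps power2_eq_square)
  then have "(t\<^sup>2 + d) * (s\<^sup>2 + d) - (s * t)\<^sup>2 = 0" using y by simp
  then have "d * (s\<^sup>2 + t\<^sup>2 + d) = 0" by (simp add: algebra_simps power2_eq_square)
  moreover have sum: "s\<^sup>2 + t\<^sup>2 + d = m" using a y unfolding A by simp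
  ultimately have d: "d = 0" using l by simp
  show "cmod a = y * \<bar>t\<bar>"
    by (rule power2_eq_imp_eq) (use A d y in \<open>simp_all add: power_mult_distrib\<close>)
  show "cmod b = y * \<bar>s\<bar>"
    by (rule power2_eq_imp_eq) (use B d y in \<open>simp_all add: power_mult_distrib\<close>)
  show "s\<^sup>2 + t\<^sup>2 = m" using sum d by simp
  have "(cmod (s *\<^sub>R a + t *\<^sub>R b))\<^sup>2 = s\<^sup>2 * (cmod a)\<^sup>2 + t\<^sup>2 * (cmod b)\<^sup>2 + 2 * s * t * Re (cnj a * b)"
    unfolding cmod_power2 by (simp add: algebra_simps power2_eq_square)
  also have "\<dots> = 0" unfolding A B re d by (simp add: algebra_simps power2_eq_square)
  finally show "s *\<^sub>R a + t *\<^sub>R b = 0" by simp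
qed

context conformal_minimal_surface begin

text \<open>
  \<open>G\<close> is the velocity of the curve traced by the horizontal part and \<open>\<omega>\<close> the differential of a harmonic
  conjugate of the height, up to sign.  The geodesic equation for \<open>G\<close> has two components: the harmonic map equation for
  the horizontal part, and the symmetry of its second derivatives together with the harmonicity
  of the height.
\<close>

lemma flat_imp_geodesic:
  assumes conn: "connected \<Omega>" "\<Omega> \<noteq> {}"
    and flat: "\<And>w. w \<in> \<Omega> \<Longrightarrow> gauss_curvature (induced_metric H2R_metric X) w = 0"
  shows "\<exists>\<Gamma>. H2_geodesic \<Gamma> \<and> (\<lambda>w. fst (X w)) ` \<Omega> \<subseteq> \<Gamma>"
proof -
  define a where "a w = fst (Xu w)" for w
  define b where "b w = fst (Xv w)" for w
  define s where "s w = snd (Xu w)" for w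
  define t where "t w = snd (Xv w)" for w
  define y where "y w = Im (fst (X w))" for w
  define G where "G w = (a w * of_real (t w) - b w * of_real (s w)) / of_real ((s w)\<^sup>2 + (t w)\<^sup>2)" for w
  define \<omega> where "\<omega> w c = t w * Re c - s w * Im c" for w c
  have y: "y w > 0" if "w \<in> \<Omega>" for w using upper[OF that] by (simp add: y_def)
  have pair: "cmod (a w) = y w * \<bar>t w\<bar>" "cmod (b w) = y w * \<bar>s w\<bar>"
    "(s w)\<^sup>2 + (t w)\<^sup>2 = l w" "s w *\<^sub>R a w + t w *\<^sub>R b w = 0" if w: "w \<in> \<Omega>" for w
  proof -
    have m: "(cmod (a w))\<^sup>2 / (y w)\<^sup>2 + (s w)\<^sup>2 = l w" "(cmod (b w))\<^sup>2 / (y w)\<^sup>2 + (t w)\<^sup>2 = l w"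
      "Re (cnj (a w) * b w) / (y w)\<^sup>2 + s w * t w = 0"
      using frame[OF w] unfolding cmod_power2
      by (simp_all add: a_def b_def s_def t_def y_def H2R_metric_def H2_metric_def inner_complex_def
          power2_eq_square)
    have "Im (cnj (a w) * b w) = 0"
      using flat_imp_parallel[OF w flat[OF w]] by (simp add: a_def b_def)
    from conformal_parallel_pair[OF y[OF w] induced_metric_eq(1)[OF w] m this]
    show "cmod (a w) = y w * \<bar>t w\<bar>" "cmod (b w) = y w * \<bar>s w\<bar>"
      "(s w)\<^sup>2 + (t w)\<^sup>2 = l w" "s w *\<^sub>R a w + t w *\<^sub>R b w = 0" by auto
  qed
  have st: "(s w)\<^sup>2 + (t w)\<^sup>2 > 0" if "w \<in> \<Omega>" for w
    unfolding pair(3)[OF that] by (rule induced_metric_eq(1)[OF that])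
  have aG: "a w = G w * of_real (t w)" and bG: "b w = - (G w * of_real (s w))" if w: "w \<in> \<Omega>" for w
  proof -
    define S where "S = complex_of_real (s w)"
    define T where "T = complex_of_real (t w)"
    define N where "N = complex_of_real ((s w)\<^sup>2 + (t w)\<^sup>2)"
    have N: "N = S\<^sup>2 + T\<^sup>2" by (simp add: N_def S_def T_def)
    have n: "N \<noteq> 0"
      unfolding N_def of_real_eq_0_iff using st[OF w] by (rule less_imp_neq[symmetric])
    have ab: "S * a w + T * b w = 0"
      using pair(4)[OF w] by (simp add: S_def T_def scaleR_conv_of_real)
    have G: "G w * N = a w * T - b w * S"
      using n by (simp add: G_def N_def S_def T_def del: of_real_add of_real_power)
    have "(a w - G w * T) * N = a w * N - (G w * N) * T" by (simp add: algebra_simps)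
    also have "\<dots> = S * (S * a w + T * b w)" unfolding G unfolding N by (simp add: algebra_simps power2_eq_square)
    finally show "a w = G w * of_real (t w)" using n ab by (simp add: T_def)
    have "(b w + G w * S) * N = b w * N + (G w * N) * S" by (simp add: algebra_simps)
    also have "\<dots> = T * (S * a w + T * b w)" unfolding G unfolding N by (simp add: algebra_simps power2_eq_square)
    finally show "b w = - (G w * of_real (s w))" using n ab by (simp add: S_def eq_neg_iff_add_eq_0)
  qed
  have G_nz: "G w \<noteq> 0" if w: "w \<in> \<Omega>" for w
  proof
    assume "G w = 0"
    then have "a w = 0" "b w = 0" using aG[OF w] bG[OF w] by auto
    then have "t w = 0" "s w = 0" using pair(1,2)[OF w] y[OF w] by auto
    then show False using st[OF w] by simp
  qed
  have dh: "((\<lambda>w. fst (X w)) has_derivative (\<lambda>c. G w * of_real (\<omega> w c))) (at w)" if w: "w \<in> \<Omega>" for w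
  proof -
    have "fst (along c X w) = G w * of_real (\<omega> w c)" for c
    proof -
      have "fst (along c X w) = of_real (Re c) * a w + of_real (Im c) * b w"
        unfolding along_eq[OF w, of c] by (simp add: a_def b_def scaleR_conv_of_real)
      then show ?thesis unfolding aG[OF w] bG[OF w] \<omega>_def by (simp add: algebra_simps)
    qed
    then show ?thesis
      using has_derivative_fst[OF smooth_on_has_derivative[OF smooth(1) w]] by simp
  qed
  have dG: "(G has_derivative (\<lambda>c. - christoffel H2_metric (fst (X w)) (G w) (G w) * of_real (\<omega> w c))) (at w)"
    if w: "w \<in> \<Omega>" for w
  proof -
    note D = smooth(2)[THEN smooth_on_has_derivative, OF w]
    have da: "(a has_derivative (\<lambda>c. fst (along c Xu w))) (at w)"
      and db: "(b has_derivative (\<lambda>c. fst (along c Xv w))) (at w)"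
      and ds: "(s has_derivative (\<lambda>c. snd (along c Xu w))) (at w)"
      and dt: "(t has_derivative (\<lambda>c. snd (along c Xv w))) (at w)"
      unfolding a_def[abs_def] b_def[abs_def] s_def[abs_def] t_def[abs_def]
      by (intro has_derivative_fst has_derivative_snd D)+
    have nst: "complex_of_real ((s w)\<^sup>2 + (t w)\<^sup>2) \<noteq> 0"
      unfolding of_real_eq_0_iff using st[OF w] by (rule less_imp_neq[symmetric])
    have "G differentiable (at w)"
      unfolding G_def[abs_def] of_real_add of_real_power
      by (intro differentiable_divide differentiable_diff differentiable_add differentiable_mult differentiable_power
          differentiableI[OF da] differentiableI[OF db]
          differentiableI[OF has_derivative_of_real, OF ds] differentiableI[OF has_derivative_of_real, OF dt])
        (use nst in simp)
    then obtain G' where G': "(G has_derivative G') (at w)" by (auto simp: differentiable_def)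
    have "((\<lambda>q. G q * of_real (t q)) has_derivative
        (\<lambda>c. G w * of_real (snd (along c Xv w)) + G' c * of_real (t w))) (at w)"
      by (intro has_derivative_mult G' has_derivative_of_real dt)
    then have "(a has_derivative (\<lambda>c. G w * of_real (snd (along c Xv w)) + G' c * of_real (t w))) (at w)"
      by (rule has_derivative_transform_within_open[OF _ open_domain w]) (simp add: aG)
    from has_derivative_unique[OF da this]
    have ea: "fst (along c Xu w) = G w * of_real (snd (along c Xv w)) + G' c * of_real (t w)" for c by meson
    have "((\<lambda>q. - (G q * of_real (s q))) has_derivative
        (\<lambda>c. - (G w * of_real (snd (along c Xu w)) + G' c * of_real (s w)))) (at w)"
      by (intro has_derivative_minus has_derivative_mult G' has_derivative_of_real ds)
    then have "(b has_derivative (\<lambda>c. - (G w * of_real (snd (along c Xu w)) + G' c * of_real (s w)))) (at w)"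
      by (rule has_derivative_transform_within_open[OF _ open_domain w]) (simp add: bG)
    from has_derivative_unique[OF db this]
    have eb: "fst (along c Xv w) = - (G w * of_real (snd (along c Xu w)) + G' c * of_real (s w))" for c by meson
    have sym: "along \<i> Xu w = along 1 Xv w"
      by (rule along_symmetric[OF smooth(1) open_domain w])
    have harm: "fst (along 1 Xu w) + fst (along \<i> Xv w) + \<i> * ((a w)\<^sup>2 + (b w)\<^sup>2) / of_real (y w) = 0"
      and lap_f: "snd (along 1 Xu w) + snd (along \<i> Xv w) = 0"
      using harmonic[OF w]
      by (simp_all add: covariant_along_H2R[where X=X, OF upper[OF w]] a_def b_def y_def prod_eq_iff
          power2_eq_square add_divide_distrib algebra_simps)
    define T where "T = complex_of_real (t w)"
    define S where "S = complex_of_real (s w)"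
    define Q where "Q = - \<i> * (G w)\<^sup>2 / of_real (y w)"
    have n: "S\<^sup>2 + T\<^sup>2 \<noteq> 0" using nst by (simp add: S_def T_def)
    have ab: "\<i> * ((a w)\<^sup>2 + (b w)\<^sup>2) / of_real (y w) = - Q * (S\<^sup>2 + T\<^sup>2)"
      unfolding aG[OF w] bG[OF w] Q_def S_def T_def by (simp add: algebra_simps power_mult_distrib add_divide_distrib)
    \<comment> \<open>The harmonic map equation with \<open>h\<^sub>u = G f\<^sub>v\<close> and \<open>h\<^sub>v = - G f\<^sub>u\<close> inserted.\<close>
    have e1: "G' 1 * T - G' \<i> * S - Q * (S\<^sup>2 + T\<^sup>2) = 0"
      using harm unfolding ab ea eb sym S_def[symmetric] T_def[symmetric] by (simp add: algebra_simps)
    \<comment> \<open>Equality of the two mixed derivatives of the horizontal part, where the terms with \<open>G\<close> cancel because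
      the height is harmonic.\<close>
    have "G w * of_real (snd (along \<i> Xv w)) + G' \<i> * T = - (G w * of_real (snd (along 1 Xu w)) + G' 1 * S)"
      using arg_cong[OF sym, of fst] unfolding ea eb S_def T_def .
    moreover have "snd (along \<i> Xv w) = - snd (along 1 Xu w)" using lap_f by simp
    ultimately have e2: "G' \<i> * T + G' 1 * S = 0" by (simp add: algebra_simps)
    \<comment> \<open>\<open>e1\<close> and \<open>e2\<close> form a linear system for the partial derivatives of \<open>G\<close> with determinant \<open>S\<^sup>2 + T\<^sup>2\<close>.\<close>
    have "(G' 1 - Q * T) * (S\<^sup>2 + T\<^sup>2)
        = T * (G' 1 * T - G' \<i> * S - Q * (S\<^sup>2 + T\<^sup>2)) + S * (G' \<i> * T + G' 1 * S)"
      by (simp add: algebra_simps power2_eq_square)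
    then have G1: "G' 1 = Q * T" using n unfolding e1 e2 by simp
    have "(G' \<i> + Q * S) * (S\<^sup>2 + T\<^sup>2)
        = T * (G' \<i> * T + G' 1 * S) - S * (G' 1 * T - G' \<i> * S - Q * (S\<^sup>2 + T\<^sup>2))"
      by (simp add: algebra_simps power2_eq_square)
    then have G2: "G' \<i> = - (Q * S)" using n unfolding e1 e2 by (simp add: add_eq_0_iff2)
    have "G' c = Q * of_real (\<omega> w c)" for c
    proof -
      have lin: "linear G'" using G' by (rule has_derivative_linear)
      have "G' c = G' (Re c *\<^sub>R 1 + Im c *\<^sub>R \<i>)" by (rule arg_cong[of _ _ G']) (simp add: complex_eq_iff)
      also have "\<dots> = Re c *\<^sub>R G' 1 + Im c *\<^sub>R G' \<i>" by (simp only: linear_add[OF lin] linear_cmul[OF lin])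
      also have "\<dots> = Q * of_real (\<omega> w c)"
        unfolding G1 G2 by (simp add: \<omega>_def S_def T_def scaleR_conv_of_real algebra_simps)
      finally show ?thesis .
    qed
    moreover have "Q = - christoffel H2_metric (fst (X w)) (G w) (G w)"
      using upper[OF w] by (simp add: christoffel_H2_metric Q_def y_def power2_eq_square mult.assoc)
    ultimately have "G' = (\<lambda>c. - christoffel H2_metric (fst (X w)) (G w) (G w) * of_real (\<omega> w c))"
      by (intro ext) simp
    then show ?thesis using G' by simp
  qed
  show ?thesis
    by (rule image_subset_H2_geodesic[OF open_domain conn upper G_nz dh dG])
qed

end

theorem corollary3:
  fixes \<Omega> :: "complex set" and h :: "complex \<Rightarrow> complex" and f :: "complex \<Rightarrow> real"
    and X :: "complex \<Rightarrow> complex \<times> real" and K :: "complex \<Rightarrow> real"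
  assumes "open \<Omega>" and "connected \<Omega>" and "\<Omega> \<noteq> {}" and "simply_connected \<Omega>"
    and "X = (\<lambda>w. (h w, f w))" and "X ` \<Omega> \<subseteq> H2 \<times> UNIV"
    and "conformal_immersion H2R_metric \<Omega> X"
    and "minimal_surface H2R_metric \<Omega> X"
    and "K = gauss_curvature (induced_metric H2R_metric X)"
  shows "(\<forall>w\<in>\<Omega>. K w = 0 \<longrightarrow> vertical_plane (tangent_plane X w)) \<and>
    ((\<forall>w\<in>\<Omega>. K w = 0) \<longrightarrow>
      (\<exists>\<Gamma>. H2_geodesic \<Gamma> \<and> X ` \<Omega> \<subseteq> vertical_cylinder \<Gamma>))"
proof -
  interpret conformal_minimal_surface \<Omega> X
  proof
    show "Im (fst (X w)) > 0" if "w \<in> \<Omega>" for w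
      using assms(6) that by (auto simp: H2_def image_subset_iff mem_Times_iff)
  qed fact+
  show ?thesis
  proof (intro conjI ballI impI)
    show "vertical_plane (tangent_plane X w)" if "w \<in> \<Omega>" "K w = 0" for w
      using flat_imp_vertical that assms(9) by simp
    assume "\<forall>w\<in>\<Omega>. K w = 0"
    then obtain \<Gamma> where "H2_geodesic \<Gamma>" "(\<lambda>w. fst (X w)) ` \<Omega> \<subseteq> \<Gamma>"
      using flat_imp_geodesic[OF assms(2,3)] assms(9) by auto
    then show "\<exists>\<Gamma>. H2_geodesic \<Gamma> \<and> X ` \<Omega> \<subseteq> vertical_cylinder \<Gamma>"
      unfolding vertical_cylinder_def image_subset_iff mem_Times_iff by blast
  qed
qed

end
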